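(* Let $\tau,\tau'$ be computable relational vocabularies containing $=$ and $\neq$, and let $\mathcal{K}\subseteq Mod(\tau)$ and $\mathcal{K}'\subseteq Mod(\tau')$ be closed under isomorphism. Let $\Gamma_e$ be a computable embedding of $\mathcal{K}$ into $\mathcal{K}'$. Then for any computable positive infinitary $\tau'$-sentence $\varphi'$ one can effectively find a computable positive infinitary $\tau$-sentence $\varphi$ such that for all $\mathcal{A}\in\mathcal{K}$, \[\mathcal{A}\models\varphi\iff\Gamma_e(\mathcal{A})\models\varphi'.\] Moreover, if $\varphi'$ is $\Sigma^p_\alpha$ (or $\Pi^p_\alpha$), then so is $\varphi$.
   Context: $Mod(\tau)$ is the set of $\tau$-structures with universe $\omega$, identified with atomic diagrams (subsets of $\omega$ coding, via a fixed effective enumeration, the atomic sentences true under $x_i\mapsto i$; no negations). An enumeration operator $\Gamma_e$ is the c.e. set $W_e$ of pairs $\langle v,m\rangle$, acting by $\Gamma_e(X)=\{m:\exists v(\langle v,m\rangle\in W_e\wedge D_v\subseteq X)\}$, where $D_v$ is the $v$th finite set in a fixed computable enumeration. $\Gamma_e$ is a computable embedding of $\mathcal{K}$ into $\mathcal{K}'$ if for every $\mathcal{A}\in\mathcal{K}$, $\Gamma_e(\mathcal{A})$ is the atomic diagram of a structure in $\mathcal{K}'$, and for all $\mathcal{A},\mathcal{B}\in\mathcal{K}$, $\mathcal{A}\cong\mathcal{B}$ iff $\Gamma_e(\mathcal{A})\cong\Gamma_e(\mathcal{B})$. Positive infinitary formulas: $\Sigma^p_0$ = finite conjunctions of atomic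 formulas, $\Pi^p_0$ = finite disjunctions of negated atomic formulas; $\Sigma^p_1$: $\bigvee_{i\in I}\exists\bar x_i\psi_i$ with $\psi_i\in\Sigma^p_0$; $\Pi^p_1$: $\bigwedge_{i\in I}\forall\bar x_i\psi_i$ with $\psi_i\in\Pi^p_0$; for $\alpha\ge2$, $\Sigma^p_\alpha$: $\bigvee_{i\in I}\exists\bar x_i(\phi_i\wedge\psi_i)$, $\Pi^p_\alpha$: $\bigwedge_{i\in I}\forall\bar x_i(\phi_i\vee\psi_i)$, $\phi_i\in\Sigma^p_{\beta_i}$, $\psi_i\in\Pi^p_{\beta_i}$, $\beta_i<\alpha$, $I$ countable. A computable positive infinitary formula is one in $\Sigma^{pc}_\alpha\cup\Pi^{pc}_\alpha$ for some computable $\alpha$, i.e. given by an index: a notation for $\alpha$ in Kleene's $\mathcal O$, with every disjunction/conjunction ranging over a c.e. set of indices of lower-level formulas. *)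

theory Defs
  imports Main "HOL-Library.Nat_Bijection"
begin

section \<open>Partial computable functions and c.e. sets\<close>

text \<open>
  Partial computable functions are presented as unary functions on the natural numbers:
  the least class containing zero, successor and the two projections of the pairing
  function \<^const>\<open>prod_encode\<close>, and closed under pairing, composition, primitive
  recursion and minimization. Functions of several arguments are
  obtained through \<^const>\<open>prod_encode\<close>.
\<close>

datatype prog =
    PZero | PSuc | PFst | PSnd
  | PPair prog prog
  | PComp prog prog
  | PRec prog prog
  | PMu prog

inductive eval :: "prog \<Rightarrow> nat \<Rightarrow> nat \<Rightarrow> bool" where
  "eval PZero x 0"
| "eval PSuc x (Suc x)"
| "eval PFst (prod_encode (x, y)) x"
| "eval PSnd (prod_encode (x, y)) y"
| "eval p x y \<Longrightarrow> eval q x z \<Longrightarrow> eval (PPair p q) x (prod_encode (y, z))"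
| "eval q x y \<Longrightarrow> eval p y z \<Longrightarrow> eval (PComp p q) x z"
| "eval p x y \<Longrightarrow> eval (PRec p q) (prod_encode (x, 0)) y"
| "eval (PRec p q) (prod_encode (x, n)) y \<Longrightarrow>
   eval q (prod_encode (x, prod_encode (n, y))) z \<Longrightarrow>
   eval (PRec p q) (prod_encode (x, Suc n)) z"
| "eval p (prod_encode (x, n)) 0 \<Longrightarrow>
   \<forall>m<n. \<exists>y. eval p (prod_encode (x, m)) (Suc y) \<Longrightarrow>
   eval (PMu p) x n"

primrec prog_code :: "prog \<Rightarrow> nat" where
  "prog_code PZero = 0"
| "prog_code PSuc = 1"
| "prog_code PFst = 2"
| "prog_code PSnd = 3"
| "prog_code (PPair p q) = 4 * prod_encode (prog_code p, prog_code q) + 4"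
| "prog_code (PComp p q) = 4 * prod_encode (prog_code p, prog_code q) + 5"
| "prog_code (PRec p q) = 4 * prod_encode (prog_code p, prog_code q) + 6"
| "prog_code (PMu p) = 4 * prog_code p + 7"

lemma bij_prog_code: "bij prog_code"
proof (rule bijI)
  have "prog_code p = prog_code q \<Longrightarrow> p = q" for p q
  proof (induction p arbitrary: q)
    case (PPair p1 p2) then show ?case by (cases q) (simp_all, presburger+)
  next
    case (PComp p1 p2) then show ?case by (cases q) (simp_all, presburger+)
  next
    case (PRec p1 p2) then show ?case by (cases q) (simp_all, presburger+)
  next
    case (PMu p) then show ?case by (cases q) (simp_all, presburger+)
  qed (case_tac [!] q, simp_all)
  then show "inj prog_code" by (rule injI)
  have "\<exists>p. prog_code p = n" for n
  proof (induction n rule: less_induct)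
    case (less n)
    show ?case
    proof (cases "n < 4")
      case True
      then have "n = 0 \<or> n = 1 \<or> n = 2 \<or> n = 3" by auto
      then show ?thesis
        using prog_code.simps(1-4) by metis
    next
      case False
      define m where "m = n div 4 - 1"
      have m: "m < n" and
        n: "n = 4 * m + 4 \<or> n = 4 * m + 5 \<or> n = 4 * m + 6 \<or> n = 4 * m + 7"
        using False unfolding m_def by presburger+
      obtain x y where xy: "m = prod_encode (x, y)"
        by (metis prod_decode_inverse surj_pair)
      have "x < n" "y < n"
        using m le_prod_encode_1[of x y] le_prod_encode_2[of y x] xy by simp_all
      then obtain p q r where "prog_code p = x" "prog_code q = y" "prog_code r = m"
        using less m by metis
      then have "prog_code (PPair p q) = 4 * m + 4" "prog_code (PComp p q) = 4 * m + 5"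
        "prog_code (PRec p q) = 4 * m + 6" "prog_code (PMu r) = 4 * m + 7"
        using xy by simp_all
      then show ?thesis using n by metis
    qed
  qed
  then show "surj prog_code" by (metis surjI)
qed

text \<open>
  \<open>phi e x y\<close> says that the \<open>e\<close>-th partial computable function is defined at \<open>x\<close> with
  value \<open>y\<close>.
\<close>

definition phi :: "nat \<Rightarrow> nat \<Rightarrow> nat \<Rightarrow> bool" where
  "phi e x y \<longleftrightarrow> (\<exists>p. prog_code p = e \<and> eval p x y)"

text \<open>
  The \<open>e\<close>-th c.e. set is taken to be the range of the \<open>e\<close>-th partial computable function.
  This numbering and the one by domains are intertranslatable by computable functions.
\<close>

definition W :: "nat \<Rightarrow> nat set" where
  "W e = {y. \<exists>x. phi e x y}"

definition computable_fun :: "(nat \<Rightarrow> nat) \<Rightarrow> bool" where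
  "computable_fun f \<longleftrightarrow> (\<exists>p. \<forall>x. eval p x (f x))"


section \<open>Kleene's system of ordinal notations\<close>

text \<open>
  The set \<open>\<O>\<close> of notations and the relation \<open><\<^sub>\<O>\<close>, defined simultaneously: \<open>1\<close> denotes 0,
  \<open>2 ^ a\<close> denotes the successor of what \<open>a\<close> denotes, and \<open>3 * 5 ^ e\<close> denotes the limit of
  the ordinals denoted by a \<open><\<^sub>\<O>\<close>-increasing sequence computed by the \<open>e\<close>-th program.
  In particular \<open>2\<close> is the only notation of the ordinal 1.
\<close>

inductive kleene_O :: "nat \<Rightarrow> bool" and less_O :: "nat \<Rightarrow> nat \<Rightarrow> bool" where
  O_zero: "kleene_O 1"
| O_succ: "kleene_O a \<Longrightarrow> kleene_O (2 ^ a)"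
| O_lim: "\<forall>n. phi e n (g n) \<Longrightarrow> \<forall>n. kleene_O (g n) \<Longrightarrow> \<forall>n. less_O (g n) (g (Suc n)) \<Longrightarrow>
    kleene_O (3 * 5 ^ e)"
| less_succ: "kleene_O a \<Longrightarrow> less_O a (2 ^ a)"
| less_succ_trans: "less_O b a \<Longrightarrow> less_O b (2 ^ a)"
| less_lim: "kleene_O (3 * 5 ^ e) \<Longrightarrow> phi e n a \<Longrightarrow> less_O b a \<Longrightarrow> less_O b (3 * 5 ^ e)"


section \<open>Vocabularies, structures and atomic diagrams\<close>

text \<open>
  A vocabulary always contains \<open>=\<close> and \<open>\<noteq>\<close>, which are built into the syntax of atomic
  formulas and interpreted as true equality and inequality. Its other relation symbols are
  coded by natural numbers: \<open>\<tau> r = Some k\<close> means that \<open>r\<close> is a \<open>k\<close>-ary relation symbol of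
  \<open>\<tau>\<close>. Computability of \<open>\<tau>\<close> means that the set of symbols is decidable and the arity of a
  symbol can be computed. Arities are positive.
\<close>

type_synonym vocab = "nat \<Rightarrow> nat option"

definition computable_vocab :: "vocab \<Rightarrow> bool" where
  "computable_vocab \<tau> \<longleftrightarrow>
     (\<forall>r k. \<tau> r = Some k \<longrightarrow> 0 < k) \<and>
     computable_fun (\<lambda>r. case \<tau> r of None \<Rightarrow> 0 | Some k \<Rightarrow> Suc k)"

text \<open>A structure has universe \<open>\<omega>\<close>; symbols outside the vocabulary are interpreted as empty.\<close>

type_synonym struct = "nat \<Rightarrow> nat list set"

definition Mod :: "vocab \<Rightarrow> struct set" where
  "Mod \<tau> = {A. \<forall>r. \<forall>xs \<in> A r. \<tau> r = Some (length xs)}"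

definition iso :: "struct \<Rightarrow> struct \<Rightarrow> bool" (infix "\<cong>" 50) where
  "A \<cong> B \<longleftrightarrow> (\<exists>h. bij h \<and> (\<forall>r xs. xs \<in> A r \<longleftrightarrow> map h xs \<in> B r))"

definition iso_closed :: "vocab \<Rightarrow> struct set \<Rightarrow> bool" where
  "iso_closed \<tau> K \<longleftrightarrow> (\<forall>A\<in>K. \<forall>B\<in>Mod \<tau>. A \<cong> B \<longrightarrow> B \<in> K)"

text \<open>Atomic formulas; variables are natural numbers, \<open>i\<close> standing for \<open>x\<^sub>i\<close>.\<close>

datatype atom = Eq nat nat | Neq nat nat | Rel nat "nat list"

primrec atom_in :: "vocab \<Rightarrow> atom \<Rightarrow> bool" where
  "atom_in \<tau> (Eq x y) \<longleftrightarrow> True"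
| "atom_in \<tau> (Neq x y) \<longleftrightarrow> True"
| "atom_in \<tau> (Rel r xs) \<longleftrightarrow> \<tau> r = Some (length xs)"

primrec atom_vars :: "atom \<Rightarrow> nat set" where
  "atom_vars (Eq x y) = {x, y}"
| "atom_vars (Neq x y) = {x, y}"
| "atom_vars (Rel r xs) = set xs"

primrec atom_sat :: "struct \<Rightarrow> (nat \<Rightarrow> nat) \<Rightarrow> atom \<Rightarrow> bool" where
  "atom_sat A s (Eq x y) \<longleftrightarrow> s x = s y"
| "atom_sat A s (Neq x y) \<longleftrightarrow> s x \<noteq> s y"
| "atom_sat A s (Rel r xs) \<longleftrightarrow> map s xs \<in> A r"

primrec atom_code :: "atom \<Rightarrow> nat" where
  "atom_code (Eq x y) = prod_encode (0, prod_encode (x, y))"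
| "atom_code (Neq x y) = prod_encode (1, prod_encode (x, y))"
| "atom_code (Rel r xs) = prod_encode (r + 2, list_encode xs)"

definition diag :: "struct \<Rightarrow> nat set" where
  "diag A = atom_code ` {\<alpha>. atom_sat A (\<lambda>i. i) \<alpha>}"

definition struct_of :: "nat set \<Rightarrow> struct" where
  "struct_of X r = {xs. atom_code (Rel r xs) \<in> X}"

lemma inj_atom_code: "inj atom_code"
proof (rule injI)
  fix \<alpha> \<beta> assume "atom_code \<alpha> = atom_code \<beta>"
  then show "\<alpha> = \<beta>" by (cases \<alpha>; cases \<beta>) (auto dest: injD[OF inj_list_encode[of UNIV]])
qed

lemma struct_of_diag: "struct_of (diag A) = A"
  by (auto simp: struct_of_def diag_def inj_image_mem_iff[OF inj_atom_code] fun_eq_iff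
      simp del: atom_code.simps)


section \<open>Enumeration operators and computable embeddings\<close>

text \<open>\<open>D\<^sub>v\<close> is \<^term>\<open>set_decode v\<close>, the set of positions of the digit 1 in binary \<open>v\<close>.\<close>

definition enum_op :: "nat \<Rightarrow> nat set \<Rightarrow> nat set" where
  "enum_op e X = {m. \<exists>v. prod_encode (v, m) \<in> W e \<and> set_decode v \<subseteq> X}"

definition op_struct :: "nat \<Rightarrow> struct \<Rightarrow> struct" where
  "op_struct e A = struct_of (enum_op e (diag A))"

definition computable_embedding :: "nat \<Rightarrow> struct set \<Rightarrow> struct set \<Rightarrow> bool" where
  "computable_embedding e K K' \<longleftrightarrow>
     (\<forall>A\<in>K. \<exists>B\<in>K'. enum_op e (diag A) = diag B) \<and>
     (\<forall>A\<in>K. \<forall>B\<in>K. A \<cong> B \<longleftrightarrow> op_struct e A \<cong> op_struct e B)"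


section \<open>Positive infinitary formulas\<close>

text \<open>
  \<open>Conj0\<close> is a finite conjunction of atomic formulas, \<open>Disj0\<close> a finite disjunction of negated
  atomic formulas; \<open>BigOr I F\<close> is the disjunction of the \<open>F i\<close> for \<open>i \<in> I\<close> only, the values
  of \<open>F\<close> outside \<open>I\<close> being irrelevant, and similarly for \<open>BigAnd\<close>.
\<close>

datatype fml =
    Conj0 "atom list"
  | Disj0 "atom list"
  | And fml fml
  | Or fml fml
  | BigOr "nat set" "nat \<Rightarrow> fml"
  | BigAnd "nat set" "nat \<Rightarrow> fml"
  | Exs "nat list" fml
  | Alls "nat list" fml

primrec sat :: "struct \<Rightarrow> fml \<Rightarrow> (nat \<Rightarrow> nat) \<Rightarrow> bool" where
  "sat A (Conj0 \<alpha>s) = (\<lambda>s. \<forall>\<alpha>\<in>set \<alpha>s. atom_sat A s \<alpha>)"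
| "sat A (Disj0 \<alpha>s) = (\<lambda>s. \<exists>\<alpha>\<in>set \<alpha>s. \<not> atom_sat A s \<alpha>)"
| "sat A (And \<phi> \<psi>) = (\<lambda>s. sat A \<phi> s \<and> sat A \<psi> s)"
| "sat A (Or \<phi> \<psi>) = (\<lambda>s. sat A \<phi> s \<or> sat A \<psi> s)"
| "sat A (BigOr I F) = (\<lambda>s. \<exists>i\<in>I. sat A (F i) s)"
| "sat A (BigAnd I F) = (\<lambda>s. \<forall>i\<in>I. sat A (F i) s)"
| "sat A (Exs xs \<phi>) = (\<lambda>s. \<exists>t. (\<forall>x. x \<notin> set xs \<longrightarrow> t x = s x) \<and> sat A \<phi> t)"
| "sat A (Alls xs \<phi>) = (\<lambda>s. \<forall>t. (\<forall>x. x \<notin> set xs \<longrightarrow> t x = s x) \<longrightarrow> sat A \<phi> t)"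

primrec FV :: "fml \<Rightarrow> nat set" where
  "FV (Conj0 \<alpha>s) = (\<Union>\<alpha>\<in>set \<alpha>s. atom_vars \<alpha>)"
| "FV (Disj0 \<alpha>s) = (\<Union>\<alpha>\<in>set \<alpha>s. atom_vars \<alpha>)"
| "FV (And \<phi> \<psi>) = FV \<phi> \<union> FV \<psi>"
| "FV (Or \<phi> \<psi>) = FV \<phi> \<union> FV \<psi>"
| "FV (BigOr I F) = (\<Union>i\<in>I. FV (F i))"
| "FV (BigAnd I F) = (\<Union>i\<in>I. FV (F i))"
| "FV (Exs xs \<phi>) = FV \<phi> - set xs"
| "FV (Alls xs \<phi>) = FV \<phi> - set xs"

definition sentence :: "fml \<Rightarrow> bool" where
  "sentence \<phi> \<longleftrightarrow> FV \<phi> = {}"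

definition models :: "struct \<Rightarrow> fml \<Rightarrow> bool" (infix "\<Turnstile>" 50) where
  "A \<Turnstile> \<phi> \<longleftrightarrow> (\<forall>s. sat A \<phi> s)"


section \<open>Computable positive infinitary formulas\<close>

text \<open>
  An index is a triple consisting of a tag (0 for \<open>\<Sigma>\<close>, 1 for \<open>\<Pi>\<close>), a notation for the level
  and a parameter. At level 0 the parameter codes a finite list of atomic formulas. At all
  higher levels it is an index of a c.e. set, whose members code the disjuncts (conjuncts):
  a member codes a tuple of variables together with an index of the quantified formula
  \<open>\<psi>\<^sub>i\<close> at level 1, and with a pair of indices, one of \<open>\<phi>\<^sub>i\<close> in \<open>\<Sigma>\<close> and one of \<open>\<psi>\<^sub>i\<close> in \<open>\<Pi>\<close> of
  the same lower level, above level 1.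
\<close>

definition Sigma_ix :: "nat \<Rightarrow> nat \<Rightarrow> nat" where
  "Sigma_ix a e = prod_encode (0, prod_encode (a, e))"

definition Pi_ix :: "nat \<Rightarrow> nat \<Rightarrow> nat" where
  "Pi_ix a e = prod_encode (1, prod_encode (a, e))"

definition mem_vars :: "nat \<Rightarrow> nat list" where
  "mem_vars i = list_decode (fst (prod_decode i))"

definition mem_ix :: "nat \<Rightarrow> nat" where
  "mem_ix i = snd (prod_decode i)"

definition mem_Sigma :: "nat \<Rightarrow> nat" where
  "mem_Sigma i = fst (prod_decode (mem_ix i))"

definition mem_Pi :: "nat \<Rightarrow> nat" where
  "mem_Pi i = snd (prod_decode (mem_ix i))"

text \<open>
  \<open>Sigma_pc \<tau> a n \<phi>\<close> says that \<open>a\<close> is a notation for a computable ordinal \<open>\<alpha>\<close> and \<open>n\<close> is an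
  index, with that notation, of the computable \<open>\<Sigma>\<^sup>p\<^sub>\<alpha>\<close> formula \<open>\<phi>\<close> over \<open>\<tau>\<close>; \<open>Pi_pc\<close> is
  the same for \<open>\<Pi>\<^sup>p\<^sub>\<alpha>\<close>.
\<close>

inductive Sigma_pc :: "vocab \<Rightarrow> nat \<Rightarrow> nat \<Rightarrow> fml \<Rightarrow> bool"
  and Pi_pc :: "vocab \<Rightarrow> nat \<Rightarrow> nat \<Rightarrow> fml \<Rightarrow> bool"
  for \<tau> :: vocab where
  Sigma_zero: "\<forall>\<alpha>\<in>set \<alpha>s. atom_in \<tau> \<alpha> \<Longrightarrow>
    Sigma_pc \<tau> 1 (Sigma_ix 1 (list_encode (map atom_code \<alpha>s))) (Conj0 \<alpha>s)"
| Pi_zero: "\<forall>\<alpha>\<in>set \<alpha>s. atom_in \<tau> \<alpha> \<Longrightarrow>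
    Pi_pc \<tau> 1 (Pi_ix 1 (list_encode (map atom_code \<alpha>s))) (Disj0 \<alpha>s)"
| Sigma_one: "\<forall>i\<in>W e. Sigma_pc \<tau> 1 (mem_ix i) (G i) \<Longrightarrow>
    Sigma_pc \<tau> 2 (Sigma_ix 2 e) (BigOr (W e) (\<lambda>i. Exs (mem_vars i) (G i)))"
| Pi_one: "\<forall>i\<in>W e. Pi_pc \<tau> 1 (mem_ix i) (G i) \<Longrightarrow>
    Pi_pc \<tau> 2 (Pi_ix 2 e) (BigAnd (W e) (\<lambda>i. Alls (mem_vars i) (G i)))"
| Sigma_step: "less_O 2 a \<Longrightarrow>
    \<forall>i\<in>W e. \<exists>b. less_O b a \<and>
      Sigma_pc \<tau> b (mem_Sigma i) (F i) \<and> Pi_pc \<tau> b (mem_Pi i) (G i) \<Longrightarrow>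
    Sigma_pc \<tau> a (Sigma_ix a e)
      (BigOr (W e) (\<lambda>i. Exs (mem_vars i) (And (F i) (G i))))"
| Pi_step: "less_O 2 a \<Longrightarrow>
    \<forall>i\<in>W e. \<exists>b. less_O b a \<and>
      Sigma_pc \<tau> b (mem_Sigma i) (F i) \<and> Pi_pc \<tau> b (mem_Pi i) (G i) \<Longrightarrow>
    Pi_pc \<tau> a (Pi_ix a e)
      (BigAnd (W e) (\<lambda>i. Alls (mem_vars i) (Or (F i) (G i))))"

end

(*
  Let f be a bijection of the natural numbers and f*A the copy of A that f pulls back. The
  embedding maps f*A to a copy of the image of A, so a sentence phi' has the same truth value in
  the images of all f*A, and it suffices to express "phi' holds in the image of f*A for
  comeagerly many f" (Pi) or "for nonmeagerly many f" (Sigma) positively in A. This is done by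
  Vaught transforms, relativized to the set of f extending a finite injective tuple p: with q
  ranging over the extensions of p,
    (exists i. phi_i & psi_i) is nonmeager below p  iff  for some q, i
       phi_i is nonmeager below q and psi_i is comeager below q,
  and dually for Pi. So Sigma formulas only need the nonmeager transform, Pi formulas only the
  comeager one, and levels are preserved. At level 1, an atomic formula holds in the image of
  f*A iff some <v, m> in W_e has D_v contained in the diagram of f*A, a finite conjunction of
  atomic formulas about f.
*)

theory Submission
  imports Defs "HOL-Library.Sublist" "HOL-Library.Countable_Set"
begin

section \<open>Computable functions\<close>

text \<open>The elements of the image are plain numbers that need not be definable from A, so no
  variable of phi can stand for them. They enter phi as parameters: free variables of subformulas of
  phi' are read in a coded environment \<open>s\<close>, and a quantifier of phi' becomes a
  countable disjunction or conjunction over codes of value tuples. The variables of phi stand for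
  the entries of the condition instead: x_i denotes the element of A that f assigns to i. The
  exchange of nonmeager and comeager rests on the Baire property of all sets of bijections involved.
  Truth of an atom in the image is a disjunction over axioms, so level 0 moves to level 1. Inside a
  formula of level 1 these disjunctions merge with the outer one, and inside higher levels the shift
  is absorbed; only sentences of level 0 need separate care. Effectiveness concerns indices: one
  fixed total program produces the members of the new c.e. set from those of the old one, so the new
  index is a computable function of the old one, whether or not the latter is valid.\<close>

abbreviation pfst :: "nat \<Rightarrow> nat" where "pfst x \<equiv> fst (prod_decode x)"
abbreviation psnd :: "nat \<Rightarrow> nat" where "psnd x \<equiv> snd (prod_decode x)"
abbreviation pair :: "nat \<Rightarrow> nat \<Rightarrow> nat" where "pair x y \<equiv> prod_encode (x, y)"

named_theorems computable

inductive_cases eval_PZeroE: "eval PZero x y"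
inductive_cases eval_PSucE: "eval PSuc x y"
inductive_cases eval_PFstE: "eval PFst x y"
inductive_cases eval_PSndE: "eval PSnd x y"
inductive_cases eval_PPairE: "eval (PPair p q) x y"
inductive_cases eval_PCompE: "eval (PComp p q) x y"
inductive_cases eval_PRecE: "eval (PRec p q) x y"
inductive_cases eval_PMuE: "eval (PMu p) x y"

lemma eval_PZero [simp]: "eval PZero x y \<longleftrightarrow> y = 0"
  by (auto elim: eval_PZeroE intro: eval.intros)

lemma eval_PSuc [simp]: "eval PSuc x y \<longleftrightarrow> y = Suc x"
  by (auto elim: eval_PSucE intro: eval.intros)

lemma eval_PFst [simp]: "eval PFst x y \<longleftrightarrow> y = pfst x"
  using eval.intros(3)[of "pfst x" "psnd x"] by (auto elim: eval_PFstE)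

lemma eval_PSnd [simp]: "eval PSnd x y \<longleftrightarrow> y = psnd x"
  using eval.intros(4)[of "pfst x" "psnd x"] by (auto elim: eval_PSndE)

lemma eval_PPair [simp]: "eval (PPair p q) x y \<longleftrightarrow> eval p x (pfst y) \<and> eval q x (psnd y)"
  using eval.intros(5)[of p x "pfst y" q "psnd y"] by (auto elim: eval_PPairE)

lemma eval_PComp [simp]: "eval (PComp p q) x z \<longleftrightarrow> (\<exists>y. eval q x y \<and> eval p y z)"
  by (auto elim: eval_PCompE intro: eval.intros)

lemma eval_PRec_0 [simp]: "eval (PRec p q) (pair x 0) y \<longleftrightarrow> eval p x y"
  by (auto elim: eval_PRecE intro: eval.intros)

lemma eval_PRec_Suc [simp]: "eval (PRec p q) (pair x (Suc n)) z \<longleftrightarrow>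
    (\<exists>y. eval (PRec p q) (pair x n) y \<and> eval q (pair x (pair n y)) z)"
  by (rule iffI, erule eval_PRecE) (auto intro: eval.intros)

lemma eval_deterministic: "eval p x y \<Longrightarrow> eval p x z \<Longrightarrow> y = z"
proof (induction arbitrary: z rule: eval.induct)
  case (5 p x y q z z')
  from 5(5) have "eval p x (pfst z')" "eval q x (psnd z')" by simp_all
  from 5(3)[OF this(1)] 5(4)[OF this(2)] show ?case by simp
next
  case (6 q x y p z z')
  from 6(5) obtain y' where y: "eval q x y'" "eval p y' z'" by (auto simp only: eval_PComp)
  show ?case using 6(3)[OF y(1)] 6(4) y(2) by blast
next
  case (7 p x y q)
  from 7(3) have "eval p x z" by simp
  then show ?case by (rule 7(2))
next
  case (8 p q x n y z z')
  from 8(5) obtain y' where y: "eval (PRec p q) (pair x n) y'" "eval q (pair x (pair n y')) z'"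
    by (auto simp only: eval_PRec_Suc)
  show ?case using 8(3)[OF y(1)] 8(4) y(2) by blast
next
  case (9 p x n)
  from 9(4) have z: "eval p (pair x z) 0" "\<forall>m<z. \<exists>y. eval p (pair x m) (Suc y)"
    by (auto elim: eval_PMuE)
  have "\<not> z < n" using 9(3) z(1) by fastforce
  moreover have "\<not> n < z" using 9(2) z(2) by fastforce
  ultimately show ?case by simp
qed simp_all

lemma computable_funE:
  assumes "computable_fun f"
  obtains p where "\<And>x y. eval p x y \<longleftrightarrow> y = f x"
  using assms unfolding computable_fun_def by (metis eval_deterministic)

lemma computable_id [computable]: "computable_fun (\<lambda>x. x)"
proof -
  have "\<forall>x. eval (PPair PFst PSnd) x x" by simp
  then show ?thesis unfolding computable_fun_def by blast
qed

lemma computable_comp: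
  assumes "computable_fun f" "computable_fun g"
  shows "computable_fun (\<lambda>x. f (g x))"
proof -
  obtain p q where "\<And>x y. eval p x y \<longleftrightarrow> y = f x" "\<And>x y. eval q x y \<longleftrightarrow> y = g x"
    using assms by (metis computable_funE)
  then have "\<forall>x. eval (PComp p q) x (f (g x))" by simp
  then show ?thesis unfolding computable_fun_def by blast
qed

lemma computable_pair [computable]:
  assumes "computable_fun f" "computable_fun g"
  shows "computable_fun (\<lambda>x. pair (f x) (g x))"
proof -
  obtain p q where "\<And>x y. eval p x y \<longleftrightarrow> y = f x" "\<And>x y. eval q x y \<longleftrightarrow> y = g x"
    using assms by (metis computable_funE)
  then have "\<forall>x. eval (PPair p q) x (pair (f x) (g x))" by simp
  then show ?thesis unfolding computable_fun_def by blast
qed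

lemma computable_pfst [computable]: "computable_fun f \<Longrightarrow> computable_fun (\<lambda>x. pfst (f x))"
  by (rule computable_comp[of "\<lambda>x. pfst x"]) (auto simp: computable_fun_def intro: exI[of _ PFst])

lemma computable_psnd [computable]: "computable_fun f \<Longrightarrow> computable_fun (\<lambda>x. psnd (f x))"
  by (rule computable_comp[of "\<lambda>x. psnd x"]) (auto simp: computable_fun_def intro: exI[of _ PSnd])

lemma computable_Suc [computable]: "computable_fun f \<Longrightarrow> computable_fun (\<lambda>x. Suc (f x))"
  by (rule computable_comp[of Suc]) (auto simp: computable_fun_def intro: exI[of _ PSuc])

fun const_prog :: "nat \<Rightarrow> prog" where
  "const_prog 0 = PZero"
| "const_prog (Suc n) = PComp PSuc (const_prog n)"

lemma eval_const_prog [simp]: "eval (const_prog n) x y \<longleftrightarrow> y = n"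
  by (induction n arbitrary: y) auto

lemma computable_const [computable]: "computable_fun (\<lambda>x. n)"
  unfolding computable_fun_def by (rule exI[of _ "const_prog n"]) simp

text \<open>\<open>PRec\<close> follows \<open>rec_nat\<close> step by step. With the other closure
  rules this makes \<open>intro computable\<close> syntax-directed: a definition built from
  \<open>rec_nat\<close>, conditionals and pairs is computable by its shape.\<close>

lemma computable_rec_nat [computable]:
  assumes "computable_fun a" "computable_fun n"
    and "computable_fun (\<lambda>y. b (pfst y) (pfst (psnd y)) (psnd (psnd y)))"
  shows "computable_fun (\<lambda>x. rec_nat (a x) (\<lambda>j u. b x j u) (n x))"
proof -
  obtain p where p: "\<And>x y. eval p x y \<longleftrightarrow> y = a x"
    by (rule computable_funE[OF assms(1)]) blast
  obtain q where q: "\<And>x y. eval q x y \<longleftrightarrow> y = b (pfst x) (pfst (psnd x)) (psnd (psnd x))"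
    by (rule computable_funE[OF assms(3)]) blast
  have "eval (PRec p q) (pair x m) (rec_nat (a x) (\<lambda>j u. b x j u) m)" for x m
    by (induction m) (auto simp: p q)
  from this[of "pfst y" "psnd y" for y]
  have "\<forall>y. eval (PRec p q) y (rec_nat (a (pfst y)) (\<lambda>j u. b (pfst y) j u) (psnd y))"
    by simp
  then have "computable_fun (\<lambda>y. rec_nat (a (pfst y)) (\<lambda>j u. b (pfst y) j u) (psnd y))"
    unfolding computable_fun_def by blast
  from computable_comp[OF this computable_pair[OF computable_id assms(2)]] show ?thesis
    by simp
qed

lemma computable_pred [computable]:
  assumes "computable_fun f" shows "computable_fun (\<lambda>x. f x - Suc 0)"
proof -
  have eq: "f x - Suc 0 = rec_nat 0 (\<lambda>j u. j) (f x)" for x by (cases "f x") auto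
  show ?thesis unfolding eq by (intro computable assms)
qed

lemma computable_add [computable]:
  assumes "computable_fun f" "computable_fun g" shows "computable_fun (\<lambda>x. f x + g x)"
proof -
  have eq: "m + n = rec_nat m (\<lambda>j u. Suc u) n" for m n :: nat by (induction n) auto
  show ?thesis unfolding eq by (intro computable assms)
qed

lemma computable_diff [computable]:
  assumes "computable_fun f" "computable_fun g" shows "computable_fun (\<lambda>x. f x - g x)"
proof -
  have "m - n = rec_nat m (\<lambda>j u. u - Suc 0) n" for m n :: nat by (induction n) auto
  then have eq: "f x - g x = rec_nat (f x) (\<lambda>j u. u - Suc 0) (g x)" for x by blast
  show ?thesis unfolding eq by (intro computable assms)
qed

lemma computable_mult [computable]:
  assumes "computable_fun f" "computable_fun g" shows "computable_fun (\<lambda>x. f x * g x)"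
proof -
  have eq: "m * n = rec_nat 0 (\<lambda>j u. u + m) n" for m n :: nat by (induction n) auto
  show ?thesis unfolding eq by (intro computable assms computable_comp[OF assms(1)])
qed

section \<open>Decidable predicates\<close>

definition decidable :: "(nat \<Rightarrow> bool) \<Rightarrow> bool" where
  "decidable P \<longleftrightarrow> computable_fun (\<lambda>x. of_bool (P x))"

lemma computable_of_bool [computable]: "decidable P \<Longrightarrow> computable_fun (\<lambda>x. of_bool (P x))"
  by (simp add: decidable_def)

lemma computable_if [computable]:
  assumes "decidable P" "computable_fun f" "computable_fun g"
  shows "computable_fun (\<lambda>x. if P x then f x else g x)"
proof -
  have eq: "(if P x then f x else g x) = of_bool (P x) * f x + (1 - of_bool (P x)) * g x" for x
    by auto
  show ?thesis unfolding eq by (intro computable assms)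
qed

lemma decidable_not [computable]:
  assumes "decidable P" shows "decidable (\<lambda>x. \<not> P x)"
proof -
  have eq: "of_bool (\<not> P x) = (1::nat) - of_bool (P x)" for x by auto
  show ?thesis unfolding decidable_def eq by (intro computable assms)
qed

lemma decidable_disj [computable]:
  assumes "decidable P" "decidable Q" shows "decidable (\<lambda>x. P x \<or> Q x)"
proof -
  have eq: "of_bool (P x \<or> Q x) = (if P x then 1 else of_bool (Q x) :: nat)" for x by auto
  show ?thesis unfolding decidable_def eq by (intro computable assms)
qed

lemma decidable_less [computable]:
  assumes "computable_fun f" "computable_fun g" shows "decidable (\<lambda>x. f x < g x)"
proof -
  have eq: "of_bool (f x < g x) = 1 - (1 - (g x - f x))" for x by auto
  show ?thesis unfolding decidable_def eq by (intro computable assms)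
qed

lemma decidable_eq [computable]:
  assumes "computable_fun f" "computable_fun g" shows "decidable (\<lambda>x. f x = g x)"
proof -
  have eq: "(f x = g x) \<longleftrightarrow> \<not> (f x < g x \<or> g x < f x)" for x by auto
  show ?thesis unfolding eq by (intro computable assms)
qed

lemma decidable_odd [computable]:
  assumes "computable_fun f" shows "decidable (\<lambda>x. odd (f x))"
proof -
  have eq: "of_bool (odd n) = rec_nat (0::nat) (\<lambda>j u. 1 - u) n" for n :: nat by (induction n) auto
  show ?thesis unfolding decidable_def eq by (intro computable assms)
qed

lemma computable_half [computable]:
  assumes "computable_fun f" shows "computable_fun (\<lambda>x. f x div 2)"
proof -
  have eq: "n div 2 = rec_nat 0 (\<lambda>j u. if odd j then Suc u else u) n" for n :: nat
    by (induction n) auto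
  show ?thesis unfolding eq by (intro computable assms)
qed

section \<open>Recursion along coded lists\<close>

abbreviation consn :: "nat \<Rightarrow> nat \<Rightarrow> nat" where "consn x l \<equiv> Suc (pair x l)"

lemma list_decode_consn [simp]: "list_decode (consn x l) = x # list_decode l"
  by simp

text \<open>A code bounds the length of its list, so it can serve as the number of iterations of a
  loop over the list.\<close>

lemma length_list_decode_le: "length (list_decode l) \<le> l"
proof (induction l rule: less_induct)
  case (less l)
  then show ?case
  proof (cases l)
    case (Suc m)
    have "psnd m \<le> m" by (metis le_prod_encode_2 prod.collapse prod_decode_inverse)
    then show ?thesis using less[of "psnd m"] Suc by (simp add: case_prod_beta)
  qed simp
qed

lemma computable_foldl:
  assumes "computable_fun i" "computable_fun l"
    and "computable_fun (\<lambda>y. g (pfst y) (pfst (psnd y)) (psnd (psnd y)))"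
  shows "computable_fun (\<lambda>x. foldl (\<lambda>u c. g x c u) (i x) (list_decode (l x)))"
proof -
  \<comment> \<open>A state is the code of the remaining list together with the accumulator. It
    stays put once the list is empty, so surplus iterations do no harm.\<close>
  define st where "st x y = (if pfst y = 0 then y
    else pair (psnd (pfst y - Suc 0)) (g x (pfst (pfst y - Suc 0)) (psnd y)))" for x y
  have it: "length (list_decode m) \<le> n \<Longrightarrow>
    psnd (rec_nat (pair m u) (\<lambda>j y. st x y) n) = foldl (\<lambda>u c. g x c u) u (list_decode m)" for n m u x
  proof (induction n arbitrary: m u)
    case (Suc n)
    \<comment> \<open>\<open>rec_nat\<close> exposes its last step, while the induction along the
      list consumes the first one.\<close>
    have shift: "rec_nat y (\<lambda>j y. st x y) (Suc n) = rec_nat (st x y) (\<lambda>j y. st x y) n" for y n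
      by (induction n) auto
    show ?case
    proof (cases m)
      case 0
      have "rec_nat (pair 0 u) (\<lambda>j y. st x y) n = pair 0 u" for n
        by (induction n) (auto simp: st_def)
      from this[of "Suc n"] show ?thesis using 0 by simp
    next
      case (Suc m')
      have "st x (pair m u) = pair (psnd m') (g x (pfst m') u)"
        by (simp add: st_def Suc)
      then show ?thesis using Suc.IH[of "psnd m'"] Suc.prems
        unfolding shift by (simp add: Suc case_prod_beta)
    qed
  qed simp
  have gc: "computable_fun (\<lambda>x. g (F x) (G x) (H x))"
    if "computable_fun F" "computable_fun G" "computable_fun H" for F G H
    using computable_comp[OF assms(3) computable_pair[OF that(1) computable_pair[OF that(2,3)]]]
    by simp
  have *: "computable_fun (\<lambda>y. st (pfst y) (psnd (psnd y)))"
    unfolding st_def by (intro computable gc)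
  have "computable_fun (\<lambda>x. psnd (rec_nat (pair (l x) (i x)) (\<lambda>j y. st x y) (l x)))"
    by (intro computable assms *)
  then show ?thesis using it[OF length_list_decode_le] by simp
qed

text \<open>A right fold is a left fold over the reversed list, and reversal is a left fold of
  \<open>consn\<close>.\<close>

lemma computable_foldr [computable]:
  assumes "computable_fun (\<lambda>y. g (pfst y) (pfst (psnd y)) (psnd (psnd y)))"
    and "computable_fun l" "computable_fun i"
  shows "computable_fun (\<lambda>x. foldr (\<lambda>c u. g x c u) (list_decode (l x)) (i x))"
proof -
  have rv: "list_decode (foldl (\<lambda>u c. consn c u) m xs) = rev xs @ list_decode m" for xs m
    by (induction xs arbitrary: m) auto
  have "computable_fun (\<lambda>x. foldl (\<lambda>u c. consn c u) 0 (list_decode (l x)))"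
    by (rule computable_foldl) (intro computable assms)+
  from computable_foldl[OF assms(3) this assms(1)] show ?thesis
    by (simp only: rv) (simp add: foldr_conv_foldl)
qed

lemma computable_comp2:
  assumes "computable_fun (\<lambda>y. F (pfst y) (psnd y))" "computable_fun f" "computable_fun g"
  shows "computable_fun (\<lambda>x. F (f x) (g x))"
  using computable_comp[OF assms(1) computable_pair[OF assms(2,3)]] by simp

lemma computable_comp3:
  assumes "computable_fun (\<lambda>y. F (pfst y) (pfst (psnd y)) (psnd (psnd y)))"
    and "computable_fun f" "computable_fun g" "computable_fun h"
  shows "computable_fun (\<lambda>x. F (f x) (g x) (h x))"
  using computable_comp[OF assms(1) computable_pair[OF assms(2) computable_pair[OF assms(3,4)]]]
  by simp

lemma foldr_consn: "foldr (\<lambda>c u. consn (f c) u) xs (list_encode ys) = list_encode (map f xs @ ys)"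
  by (induction xs) auto

lemma foldr_consn_0: "foldr (\<lambda>c u. consn (f c) u) xs 0 = list_encode (map f xs)"
  using foldr_consn[of f xs "[]"] by simp

section \<open>Coded environments\<close>

text \<open>An environment is a coded association list; variables that do not occur get the value 0.\<close>

definition lookup :: "nat \<Rightarrow> nat \<Rightarrow> nat" where
  "lookup s x = foldr (\<lambda>p u. if pfst p = x then psnd p else u) (list_decode s) 0"

definition update :: "nat \<Rightarrow> nat \<Rightarrow> nat \<Rightarrow> nat" where
  "update xs t s = foldr (\<lambda>x u. consn (pair x (lookup t x)) u) (list_decode xs) s"

lemma computable_lookup [computable]:
  "computable_fun f \<Longrightarrow> computable_fun g \<Longrightarrow> computable_fun (\<lambda>x. lookup (f x) (g x))"
  by (rule computable_comp2[of lookup]) (unfold lookup_def, intro computable)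

lemma computable_update [computable]:
  "computable_fun f \<Longrightarrow> computable_fun g \<Longrightarrow> computable_fun h \<Longrightarrow>
    computable_fun (\<lambda>x. update (f x) (g x) (h x))"
  by (rule computable_comp3[of update]) (unfold update_def, intro computable)

lemma lookup_update:
  "lookup (update xs t s) x = (if x \<in> set (list_decode xs) then lookup t x else lookup s x)"
proof -
  have "lookup (foldr (\<lambda>x u. consn (pair x (lookup t x)) u) ys s) x =
    (if x \<in> set ys then lookup t x else lookup s x)" for ys
    by (induction ys) (auto simp: lookup_def)
  then show ?thesis by (simp add: update_def)
qed

lemma lookup_surj: "\<exists>t. \<forall>x\<in>set xs. lookup t x = g x"
proof -
  have "foldr (\<lambda>p u. if pfst p = x then psnd p else u) (map (\<lambda>x. pair x (g x)) xs) 0 =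
    (if x \<in> set xs then g x else 0)" for x
    by (induction xs) auto
  then show ?thesis
    by (intro exI[of _ "list_encode (map (\<lambda>x. pair x (g x)) xs)"]) (simp add: lookup_def)
qed

text \<open>Only finitely many values of an assignment are changed, and a number can code them.
  Quantifiers over assignments thus become countable, as category arguments require.\<close>

lemma ex_override_iff:
  "(\<exists>g. (\<forall>x. x \<notin> set xs \<longrightarrow> g x = s x) \<and> P g) \<longleftrightarrow>
    (\<exists>t. P (\<lambda>x. if x \<in> set xs then lookup t x else s x))"
proof
  assume "\<exists>g. (\<forall>x. x \<notin> set xs \<longrightarrow> g x = s x) \<and> P g"
  then obtain g where g: "\<forall>x. x \<notin> set xs \<longrightarrow> g x = s x" "P g" by blast
  obtain t where "\<forall>x\<in>set xs. lookup t x = g x" using lookup_surj by blast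
  then have "(\<lambda>x. if x \<in> set xs then lookup t x else s x) = g" using g(1) by auto
  then show "\<exists>t. P (\<lambda>x. if x \<in> set xs then lookup t x else s x)" using g(2) by blast
next
  assume "\<exists>t. P (\<lambda>x. if x \<in> set xs then lookup t x else s x)"
  then obtain t where "P (\<lambda>x. if x \<in> set xs then lookup t x else s x)" by blast
  then show "\<exists>g. (\<forall>x. x \<notin> set xs \<longrightarrow> g x = s x) \<and> P g"
    by (intro exI[of _ "\<lambda>x. if x \<in> set xs then lookup t x else s x"]) simp
qed

lemma ex_update_iff:
  "(\<exists>g. (\<forall>x. x \<notin> set (list_decode xs) \<longrightarrow> g x = lookup s x) \<and> P g) \<longleftrightarrow>
    (\<exists>t. P (lookup (update xs t s)))"
proof -
  have "lookup (update xs t s) =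
    (\<lambda>x. if x \<in> set (list_decode xs) then lookup t x else lookup s x)" for t
    by (simp add: fun_eq_iff lookup_update)
  then show ?thesis by (simp only: ex_override_iff)
qed

section \<open>Substitution in coded atomic formulas\<close>

primrec subst_atom :: "(nat \<Rightarrow> nat) \<Rightarrow> atom \<Rightarrow> atom" where
  "subst_atom t (Eq x y) = Eq (t x) (t y)"
| "subst_atom t (Neq x y) = Neq (t x) (t y)"
| "subst_atom t (Rel r xs) = Rel r (map t xs)"

text \<open>The tags 0, 1 and \<open>r + 2\<close> exhaust the numbers, and every number codes a
  pair and a list. Hence every member of a premise D_v can be read as an atom, possibly an
  ill-formed one.\<close>

lemma surj_atom_code: "surj atom_code"
proof -
  have "\<exists>\<alpha>. atom_code \<alpha> = c" for c
  proof -
    obtain a b where c: "c = pair a b" by (metis prod_decode_inverse surj_pair)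
    obtain x y where b: "b = pair x y" by (metis prod_decode_inverse surj_pair)
    consider "a = 0" | "a = 1" | "a = (a - 2) + 2" by linarith
    then show ?thesis
    proof cases
      case 1 then show ?thesis using c b by (intro exI[of _ "Eq x y"]) simp
    next
      case 2 then show ?thesis using c b by (intro exI[of _ "Neq x y"]) simp
    next
      case 3
      then show ?thesis using c
        by (intro exI[of _ "Rel (a - 2) (list_decode b)"]) (simp del: add_2_eq_Suc add_2_eq_Suc')
    qed
  qed
  then show ?thesis by (metis surjI)
qed

definition atom_of :: "nat \<Rightarrow> atom" where "atom_of = inv atom_code"

lemma atom_of_atom_code [simp]: "atom_of (atom_code \<alpha>) = \<alpha>"
  by (simp add: atom_of_def inj_atom_code)

lemma atom_code_atom_of [simp]: "atom_code (atom_of c) = c"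
  by (simp add: atom_of_def surj_atom_code surj_f_inv_f)

lemma atom_code_mem_diag: "atom_code \<alpha> \<in> diag A \<longleftrightarrow> atom_sat A (\<lambda>i. i) \<alpha>"
  unfolding diag_def by (simp add: inj_image_mem_iff[OF inj_atom_code] del: atom_code.simps)

text \<open>A diagram reads x_i as the number i, so truth under an assignment becomes membership in
  the diagram once the values are substituted for the variables.\<close>

lemma atom_sat_subst: "atom_sat A (\<lambda>i. i) (subst_atom s \<alpha>) = atom_sat A s \<alpha>"
  by (cases \<alpha>) auto

definition subst_code :: "nat \<Rightarrow> nat \<Rightarrow> nat" where
  "subst_code t c = pair (pfst c)
    (if pfst c < 2 then pair (lookup t (pfst (psnd c))) (lookup t (psnd (psnd c)))
     else foldr (\<lambda>x u. consn (lookup t x) u) (list_decode (psnd c)) 0)"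

definition subst_codes :: "nat \<Rightarrow> nat \<Rightarrow> nat" where
  "subst_codes t l = foldr (\<lambda>c u. consn (subst_code t c) u) (list_decode l) 0"

lemma computable_subst_code [computable]:
  "computable_fun f \<Longrightarrow> computable_fun g \<Longrightarrow> computable_fun (\<lambda>x. subst_code (f x) (g x))"
  by (rule computable_comp2[of subst_code]) (unfold subst_code_def, intro computable)

lemma computable_subst_codes [computable]:
  "computable_fun f \<Longrightarrow> computable_fun g \<Longrightarrow> computable_fun (\<lambda>x. subst_codes (f x) (g x))"
  by (rule computable_comp2[of subst_codes]) (unfold subst_codes_def, intro computable)

lemma subst_code_atom_code: "subst_code t (atom_code \<alpha>) = atom_code (subst_atom (lookup t) \<alpha>)"
  by (cases \<alpha>) (simp_all add: subst_code_def foldr_consn_0)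

lemma subst_codes_list_encode:
  "subst_codes t (list_encode (map atom_code \<alpha>s)) =
    list_encode (map (\<lambda>\<alpha>. atom_code (subst_atom (lookup t) \<alpha>)) \<alpha>s)"
  by (simp add: subst_codes_def foldr_consn_0 subst_code_atom_code comp_def)

section \<open>Coded lists of atomic formulas\<close>

text \<open>Here \<open>w\<close> is a list of axioms <v, m> of the operator, and the result lists
  their conclusions m.\<close>

definition psnds :: "nat \<Rightarrow> nat" where
  "psnds w = foldr (\<lambda>z u. consn (psnd z) u) (list_decode w) 0"

text \<open>The inner recursion computes \<open>v div 2 ^ k\<close>. Running \<open>k\<close> up to
  \<open>v\<close> is enough, because bit \<open>k\<close> of \<open>v\<close> can only be set if
  \<open>k < v\<close>.\<close>

definition bits :: "nat \<Rightarrow> nat" where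
  "bits v = rec_nat 0 (\<lambda>k u. if odd (rec_nat v (\<lambda>j y. y div 2) k) then consn k u else u) v"

definition range_code :: "nat \<Rightarrow> nat \<Rightarrow> nat" where
  "range_code k m = rec_nat 0 (\<lambda>j u. consn (k + j) u) m"

definition false_code :: nat where "false_code = pair 1 (pair 0 0)"

definition distinct_code :: "nat \<Rightarrow> nat" where
  "distinct_code k = foldr (\<lambda>i u.
      foldr (\<lambda>j u. if i = j then u else consn (pair 1 (pair i j)) u) (list_decode (range_code 0 k)) u)
    (list_decode (range_code 0 k)) 0"

text \<open>Ill-formed atoms are never true in a structure of the vocabulary, so a false one replaces them.\<close>

definition sanitize :: "vocab \<Rightarrow> nat \<Rightarrow> nat" where
  "sanitize \<tau> c = (if pfst c < 2 then c
    else if (case \<tau> (pfst c - 2) of None \<Rightarrow> 0 | Some k \<Rightarrow> Suc k) =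
      Suc (foldr (\<lambda>x u. Suc u) (list_decode (psnd c)) 0) then c
    else false_code)"

text \<open>A diagram entry about numbers and the atom about the corresponding variables have the
  same code, so the premises of the axioms in \<open>w\<close> are copied as they are, apart from
  sanitizing. The distinctness part makes the values of the variables an initial segment of a
  bijection.\<close>

definition atoms_code :: "vocab \<Rightarrow> nat \<Rightarrow> nat \<Rightarrow> nat" where
  "atoms_code \<tau> w k = foldr (\<lambda>z u.
      foldr (\<lambda>c u. consn (sanitize \<tau> c) u) (list_decode (bits (pfst z))) u)
    (list_decode w) (distinct_code k)"

lemma computable_psnds [computable]: "computable_fun f \<Longrightarrow> computable_fun (\<lambda>x. psnds (f x))"
  by (rule computable_comp[of psnds]) (unfold psnds_def, intro computable)

lemma computable_bits [computable]: "computable_fun f \<Longrightarrow> computable_fun (\<lambda>x. bits (f x))"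
  by (rule computable_comp[of bits]) (unfold bits_def, intro computable)

lemma computable_range_code [computable]:
  "computable_fun f \<Longrightarrow> computable_fun g \<Longrightarrow> computable_fun (\<lambda>x. range_code (f x) (g x))"
  by (rule computable_comp2[of range_code]) (unfold range_code_def, intro computable)

lemma computable_distinct_code [computable]:
  "computable_fun f \<Longrightarrow> computable_fun (\<lambda>x. distinct_code (f x))"
  by (rule computable_comp[of distinct_code]) (unfold distinct_code_def, intro computable)

lemma computable_sanitize [computable]:
  assumes "computable_vocab \<tau>" "computable_fun f"
  shows "computable_fun (\<lambda>x. sanitize \<tau> (f x))"
proof (rule computable_comp[of "sanitize \<tau>"])
  define ar where "ar r = (case \<tau> r of None \<Rightarrow> 0 | Some k \<Rightarrow> Suc k)" for r
  have ar: "computable_fun ar"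
    using assms(1) by (simp add: computable_vocab_def ar_def[abs_def])
  show "computable_fun (sanitize \<tau>)"
    unfolding sanitize_def ar_def[symmetric] by (intro computable computable_comp[OF ar])
qed fact

lemma computable_atoms_code [computable]:
  assumes "computable_vocab \<tau>" "computable_fun f" "computable_fun g"
  shows "computable_fun (\<lambda>x. atoms_code \<tau> (f x) (g x))"
proof (rule computable_comp2[of "atoms_code \<tau>"])
  show "computable_fun (\<lambda>y. atoms_code \<tau> (pfst y) (psnd y))"
    unfolding atoms_code_def by (intro computable assms(1))
qed (fact assms)+

lemma psnds_eq: "psnds w = list_encode (map psnd (list_decode w))"
  by (simp add: psnds_def foldr_consn_0)

lemma set_bits: "set (list_decode (bits v)) = set_decode v"
proof -
  have half: "rec_nat v (\<lambda>j y. y div 2) k = v div 2 ^ k" for k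
    by (induction k) (simp_all add: div_mult2_eq power_Suc2 del: power_Suc)
  have "set (list_decode (rec_nat 0 (\<lambda>k u. if odd (v div 2 ^ k) then consn k u else u) n)) =
    {k. k < n \<and> odd (v div 2 ^ k)}" for n
    by (induction n) (auto simp: less_Suc_eq)
  moreover have "k < v" if "odd (v div 2 ^ k)" for k
  proof (rule ccontr)
    assume "\<not> k < v"
    then have "v < 2 ^ k" by (metis less_exp not_less order.strict_trans1)
    then show False using that by simp
  qed
  ultimately show ?thesis by (auto simp: bits_def half set_decode_def)
qed

lemma set_range_code: "set (list_decode (range_code k m)) = {k..<k + m}"
  unfolding range_code_def by (induction m) auto

lemma set_distinct_code:
  "set (list_decode (distinct_code k)) = atom_code ` {Neq i j | i j. i < k \<and> j < k \<and> i \<noteq> j}"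
proof -
  have "set (list_decode (foldr (\<lambda>j u. if i = j then u else consn (pair 1 (pair i j)) u) ys u)) =
    {pair 1 (pair i j) | j. j \<in> set ys \<and> i \<noteq> j} \<union> set (list_decode u)" for i ys u
    by (induction ys) auto
  then have *: "set (list_decode (foldr (\<lambda>i u.
      foldr (\<lambda>j u. if i = j then u else consn (pair 1 (pair i j)) u) ys u) xs 0)) =
    {pair 1 (pair i j) | i j. i \<in> set xs \<and> j \<in> set ys \<and> i \<noteq> j}" for xs ys
    by (induction xs) auto
  have "atom_code ` {Neq i j | i j. i < k \<and> j < k \<and> i \<noteq> j} =
    {pair 1 (pair i j) | i j. i < k \<and> j < k \<and> i \<noteq> j}"
    by (force simp: image_iff)
  then show ?thesis by (simp add: distinct_code_def * set_range_code)
qed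

lemma set_atoms_code:
  "set (list_decode (atoms_code \<tau> w k)) =
    sanitize \<tau> ` (\<Union>z\<in>set (list_decode w). set_decode (pfst z)) \<union> set (list_decode (distinct_code k))"
proof -
  have "set (list_decode (foldr (\<lambda>c u. consn (sanitize \<tau> c) u) ys u)) =
    sanitize \<tau> ` set ys \<union> set (list_decode u)" for ys u
    by (induction ys) auto
  then have "set (list_decode (foldr (\<lambda>z u.
      foldr (\<lambda>c u. consn (sanitize \<tau> c) u) (list_decode (bits (pfst z))) u) zs u)) =
    sanitize \<tau> ` (\<Union>z\<in>set zs. set_decode (pfst z)) \<union> set (list_decode u)" for zs u
    by (induction zs) (auto simp: set_bits)
  then show ?thesis by (simp add: atoms_code_def)
qed

lemma foldr_Suc_length: "foldr (\<lambda>x u. Suc u) xs 0 = length xs"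
  by (induction xs) auto

lemma atom_of_false_code [simp]: "atom_of false_code = Neq 0 0"
  using atom_of_atom_code[of "Neq 0 0"] by (simp add: false_code_def)

lemma sanitize_eq: "sanitize \<tau> c = (if atom_in \<tau> (atom_of c) then c else false_code)"
proof -
  have "sanitize \<tau> (atom_code \<alpha>) = (if atom_in \<tau> \<alpha> then atom_code \<alpha> else false_code)" for \<alpha>
    by (cases \<alpha>) (auto simp: sanitize_def foldr_Suc_length split: option.splits)
  from this[of "atom_of c"] show ?thesis by simp
qed

lemma atom_in_sanitize: "atom_in \<tau> (atom_of (sanitize \<tau> c))"
  by (simp add: sanitize_eq)

lemma atom_sat_atom_in: "A \<in> Mod \<tau> \<Longrightarrow> atom_sat A s \<alpha> \<Longrightarrow> atom_in \<tau> \<alpha>"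
  by (cases \<alpha>) (auto simp: Mod_def)

lemma atom_sat_sanitize:
  assumes "A \<in> Mod \<tau>"
  shows "atom_sat A s (atom_of (sanitize \<tau> c)) \<longleftrightarrow> atom_sat A s (atom_of c)"
  using atom_sat_atom_in[OF assms] by (auto simp: sanitize_eq)

lemma less_list_encode: "x \<in> set xs \<Longrightarrow> x < list_encode xs"
proof (induction xs)
  case (Cons y ys)
  then show ?case
    using le_prod_encode_1[of y "list_encode ys"] le_prod_encode_2[of "list_encode ys" y]
    by (auto simp: less_Suc_eq_le intro: order.trans less_imp_le)
qed simp

lemma atom_vars_le: "x \<in> atom_vars \<alpha> \<Longrightarrow> x \<le> atom_code \<alpha>"
proof (cases \<alpha>)
  case (Rel r xs)
  then show "x \<in> atom_vars \<alpha> \<Longrightarrow> ?thesis"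
    using less_list_encode[of x xs] le_prod_encode_2[of "list_encode xs" "r + 2"] by simp
qed (auto intro: order.trans[OF le_prod_encode_1 le_prod_encode_2]
    order.trans[OF le_prod_encode_2 le_prod_encode_2])

lemma atom_vars_sanitize: "atom_vars (atom_of (sanitize \<tau> c)) \<subseteq> {..c}"
proof -
  show ?thesis using atom_vars_le[of _ "atom_of c"] by (auto simp: sanitize_eq)
qed

lemma set_decode_less: "c \<in> set_decode v \<Longrightarrow> c < v"
proof -
  assume "c \<in> set_decode v"
  then have "odd (v div 2 ^ c)" by (simp add: set_decode_def)
  then have "2 ^ c \<le> v" by (metis div_less even_zero not_less)
  then show "c < v" by (metis less_exp order.strict_trans2)
qed

text \<open>Codes bound their components, so the premises of axioms in \<open>w\<close> only mention
  variables below \<open>w\<close>. A condition of length at least \<open>w\<close> therefore fixes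
  their truth.\<close>

lemma set_decode_pfst_less:
  assumes "z \<in> set (list_decode w)" "c \<in> set_decode (pfst z)" shows "c < w"
proof -
  have "pfst z \<le> z" by (metis le_prod_encode_1 prod.collapse prod_decode_inverse)
  then show ?thesis
    using set_decode_less[OF assms(2)] less_list_encode[OF assms(1)] by simp
qed

lemma atoms_code_vars:
  assumes "c \<in> set (list_decode (atoms_code \<tau> w k))" "w \<le> k"
  shows "atom_vars (atom_of c) \<subseteq> {..<k}"
  using assms set_decode_pfst_less atom_vars_sanitize
  unfolding set_atoms_code set_distinct_code by (force simp del: atom_code.simps)

lemma atoms_code_atom_in: "c \<in> set (list_decode (atoms_code \<tau> w k)) \<Longrightarrow> atom_in \<tau> (atom_of c)"
  unfolding set_atoms_code set_distinct_code by (auto simp: atom_in_sanitize simp del: atom_code.simps)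

lemma atoms_code_sat:
  assumes "A \<in> Mod \<tau>"
  shows "(\<forall>c\<in>set (list_decode (atoms_code \<tau> w k)). atom_sat A s (atom_of c)) \<longleftrightarrow>
    distinct (map s [0..<k]) \<and>
    (\<forall>z\<in>set (list_decode w). \<forall>c\<in>set_decode (pfst z). atom_sat A s (atom_of c))"
proof -
  have "(\<forall>c\<in>set (list_decode (distinct_code k)). atom_sat A s (atom_of c)) \<longleftrightarrow> inj_on s {..<k}"
    unfolding set_distinct_code inj_on_def by (auto simp del: atom_code.simps) (metis atom_sat.simps(2))
  then show ?thesis
    by (auto simp: set_atoms_code ball_Un atom_sat_sanitize[OF assms] distinct_map atLeast0LessThan)
qed

section \<open>The index translation\<close>

text \<open>The constants are those of \<open>prog_code\<close>; in \<open>const_code\<close>, 0 and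
  1 are the codes of \<open>PZero\<close> and \<open>PSuc\<close>. Assembling codes computably is
  the s-m-n theorem done by hand.\<close>

definition ppair_code :: "nat \<Rightarrow> nat \<Rightarrow> nat" where "ppair_code p q = 4 * pair p q + 4"
definition pcomp_code :: "nat \<Rightarrow> nat \<Rightarrow> nat" where "pcomp_code p q = 4 * pair p q + 5"
definition const_code :: "nat \<Rightarrow> nat" where "const_code n = rec_nat 0 (\<lambda>j u. pcomp_code 1 u) n"

text \<open>The numbers 2 and 3 are the codes of \<open>PFst\<close> and \<open>PSnd\<close>. On
  input (a, (b, z)) the program runs \<open>d\<close> on a and \<open>q\<close> on b, and hands both
  results, z and the constant \<open>c\<close> to the program \<open>r\<close>. As c.e. sets are
  ranges, this enumerates an image of the product of \<open>W d\<close>, \<open>W q\<close> and the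
  natural numbers.\<close>

definition enum_code :: "nat \<Rightarrow> nat \<Rightarrow> nat \<Rightarrow> nat \<Rightarrow> nat" where
  "enum_code q r d c = pcomp_code r (ppair_code (pcomp_code d 2)
    (ppair_code (pcomp_code q (pcomp_code 2 3)) (ppair_code (pcomp_code 3 3) (const_code c))))"

lemma computable_ppair_code [computable]:
  "computable_fun f \<Longrightarrow> computable_fun g \<Longrightarrow> computable_fun (\<lambda>x. ppair_code (f x) (g x))"
  unfolding ppair_code_def by (intro computable)

lemma computable_pcomp_code [computable]:
  "computable_fun f \<Longrightarrow> computable_fun g \<Longrightarrow> computable_fun (\<lambda>x. pcomp_code (f x) (g x))"
  unfolding pcomp_code_def by (intro computable)

lemma computable_const_code [computable]:
  "computable_fun f \<Longrightarrow> computable_fun (\<lambda>x. const_code (f x))"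
  unfolding const_code_def by (intro computable)

lemma computable_enum_code [computable]:
  "computable_fun r \<Longrightarrow> computable_fun d \<Longrightarrow> computable_fun c \<Longrightarrow>
    computable_fun (\<lambda>x. enum_code q (r x) (d x) (c x))"
  unfolding enum_code_def by (intro computable)

lemma const_code: "const_code n = prog_code (const_prog n)"
  by (induction n) (simp_all add: const_code_def pcomp_code_def)

lemma W_prog_code: "W (prog_code p) = {y. \<exists>x. eval p x y}"
  using bij_prog_code by (auto simp: W_def phi_def bij_def inj_eq)

lemma W_const_code: "W (const_code n) = {n}"
  by (simp add: const_code W_prog_code)

lemma W_enum_code:
  assumes "\<And>x y. eval p x y \<longleftrightarrow> y = M x"
  shows "W (enum_code q (prog_code p) d c) =
    {M (pair i (pair w (pair z c))) | i w z. i \<in> W d \<and> w \<in> W q}"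
proof -
  obtain Q D where Q: "prog_code Q = q" and D: "prog_code D = d"
    using bij_prog_code by (metis bij_pointE)
  define E where "E = PComp p (PPair (PComp D PFst)
    (PPair (PComp Q (PComp PFst PSnd)) (PPair (PComp PSnd PSnd) (const_prog c))))"
  have "enum_code q (prog_code p) d c = prog_code E"
    by (simp add: E_def enum_code_def pcomp_code_def ppair_code_def const_code Q D)
  moreover have "(\<exists>x. eval E x y) \<longleftrightarrow>
    (\<exists>i w z. y = M (pair i (pair w (pair z c))) \<and> i \<in> W d \<and> w \<in> W q)" for y
  proof
    assume "\<exists>x. eval E x y"
    then obtain x v where v: "y = M v" "eval D (pfst x) (pfst v)"
      "eval Q (pfst (psnd x)) (pfst (psnd v))" "psnd (psnd (psnd v)) = c"
      by (auto simp: E_def assms)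
    then have "y = M (pair (pfst v) (pair (pfst (psnd v)) (pair (pfst (psnd (psnd v))) c)))"
      by auto
    moreover have "pfst v \<in> W d" "pfst (psnd v) \<in> W q"
      using v(2,3) unfolding Q[symmetric] D[symmetric] W_prog_code by blast+
    ultimately show "\<exists>i w z. y = M (pair i (pair w (pair z c))) \<and> i \<in> W d \<and> w \<in> W q"
      by blast
  next
    assume "\<exists>i w z. y = M (pair i (pair w (pair z c))) \<and> i \<in> W d \<and> w \<in> W q"
    then obtain i w z a b where "y = M (pair i (pair w (pair z c)))" "eval D a i" "eval Q b w"
      unfolding Q[symmetric] D[symmetric] W_prog_code by blast
    then have "eval E (pair a (pair b z)) y" by (auto simp: E_def assms intro!: exI[of _ "pair i (pair w (pair z c))"])
    then show "\<exists>x. eval E x y" by blast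
  qed
  ultimately show ?thesis by (simp add: W_prog_code)
qed

text \<open>The input (x, n) carries n arguments; the enumeration of \<open>W e\<close> is run on
  each and the results are collected. If one run diverges, so does the whole, which is harmless
  because only the range counts.\<close>

lemma ce_lists: "\<exists>q. W q = {w. set (list_decode w) \<subseteq> W e}"
proof -
  obtain p where p: "prog_code p = e" using bij_prog_code by (metis bij_pointE)
  \<comment> \<open>A number codes an infinite sequence by iterated pairing.\<close>
  define nth where "nth x n = pfst (rec_nat x (\<lambda>j u. psnd u) n)" for x n
  have "computable_fun (\<lambda>y. nth (pfst y) (pfst (psnd y)))"
    unfolding nth_def by (intro computable)
  then obtain N where N: "\<And>x y. eval N x y \<longleftrightarrow> y = nth (pfst x) (pfst (psnd x))"
    by (rule computable_funE) blast
  \<comment> \<open>Each round puts its output in front, which accounts for the reversal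
    below.\<close>
  define Q where "Q = PRec PZero (PComp PSuc (PPair (PComp p N) (PComp PSnd PSnd)))"
  have Q: "eval Q (pair x n) w \<longleftrightarrow> length (list_decode w) = n \<and>
      (\<forall>j<n. eval p (nth x j) (rev (list_decode w) ! j))" for x n w
  proof (induction n arbitrary: w)
    case 0
    have "length (list_decode w) = 0 \<longleftrightarrow> w = 0" by (cases w) (auto simp: case_prod_beta)
    then show ?case by (simp add: Q_def)
  next
    case (Suc n)
    have "eval Q (pair x (Suc n)) w \<longleftrightarrow> (\<exists>v z. eval Q (pair x n) v \<and>
      eval p (nth x n) z \<and> w = consn z v)"
    proof -
      have "(\<exists>y. eval p (nth x n) (pfst y) \<and> psnd y = v \<and> w = Suc y) \<longleftrightarrow>
        (\<exists>z. eval p (nth x n) z \<and> w = consn z v)" for v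
        by (metis fst_conv prod.collapse prod_decode_inverse prod_encode_inverse snd_conv)
      then show ?thesis by (simp add: Q_def N)
    qed
    also have "\<dots> \<longleftrightarrow> length (list_decode w) = Suc n \<and>
      (\<forall>j<Suc n. eval p (nth x j) (rev (list_decode w) ! j))" (is "?L = ?R")
    proof
      assume ?L
      then obtain v z where "eval Q (pair x n) v" "eval p (nth x n) z" "w = consn z v" by blast
      then show ?R by (auto simp: Suc.IH nth_append less_Suc_eq)
    next
      assume R: ?R
      then obtain z v where w: "w = consn z v"
        by (cases w) (auto simp: case_prod_beta, metis prod.collapse prod_decode_inverse)
      then have "length (list_decode v) = n" using R by simp
      moreover have "eval p (nth x j) (rev (list_decode v) ! j)" if "j < n" for j
        using R that w by (auto simp: nth_append dest!: spec[of _ j])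
      moreover have "eval p (nth x n) z"
        using R w by (auto simp: nth_append dest!: spec[of _ n])
      ultimately show ?L using w Suc.IH by blast
    qed
    finally show ?case .
  qed
  have nth_surj: "\<exists>x. \<forall>j<length xs. nth x j = xs ! j" for xs
  proof (induction xs)
    case (Cons y ys)
    then obtain x where x: "\<forall>j<length ys. nth x j = ys ! j" by blast
    have "rec_nat (pair y x) (\<lambda>j u. psnd u) (Suc j) = rec_nat x (\<lambda>j u. psnd u) j" for j
      by (induction j) auto
    then have "\<forall>j<length (y # ys). nth (pair y x) j = (y # ys) ! j"
      using x by (auto simp: nth_def less_Suc_eq_0_disj)
    then show ?case by blast
  qed simp
  have "(\<exists>x. eval Q x w) \<longleftrightarrow> set (list_decode w) \<subseteq> W e" for w
  proof
    assume "\<exists>x. eval Q x w"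
    then obtain x n where "eval Q (pair x n) w" by (metis prod.collapse prod_decode_inverse)
    then have "\<forall>j<length (list_decode w). rev (list_decode w) ! j \<in> W e"
      unfolding Q p[symmetric] W_prog_code by blast
    then have "set (rev (list_decode w)) \<subseteq> W e" by (metis in_set_conv_nth length_rev subsetI)
    then show "set (list_decode w) \<subseteq> W e" by simp
  next
    assume w: "set (list_decode w) \<subseteq> W e"
    have "\<exists>u. eval p u (rev (list_decode w) ! j)" if "j < length (list_decode w)" for j
    proof -
      have "rev (list_decode w) ! j \<in> set (rev (list_decode w))"
        using that by (intro nth_mem) simp
      then show ?thesis using w unfolding p[symmetric] W_prog_code by auto
    qed
    then obtain u where u: "\<And>j. j < length (list_decode w) \<Longrightarrow> eval p (u j) (rev (list_decode w) ! j)"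
      by metis
    obtain x where "\<forall>j<length (list_decode w). nth x j = u j"
      using nth_surj[of "map u [0..<length (list_decode w)]"] by auto
    then have "eval Q (pair x (length (list_decode w))) w" using u unfolding Q by simp
    then show "\<exists>x. eval Q x w" by blast
  qed
  then have "W (prog_code Q) = {w. set (list_decode w) \<subseteq> W e}" by (simp add: W_prog_code)
  then show ?thesis by blast
qed

text \<open>The notations 1 and 2 stand for the ordinals 0 and 1.\<close>

definition trans_level :: "nat \<Rightarrow> nat" where "trans_level a = (if a = 1 then 2 else a)"

text \<open>
  \<open>n\<close> is the index to be translated, \<open>k\<close> the length of the condition and \<open>s\<close> the environment.
  A formula of level 0 is treated as a disjunction (conjunction) with a single member.
  The parameter \<open>r\<close> is going to be the code of a program for \<open>member\<close> below; passing
  it along replaces an appeal to the recursion theorem.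
\<close>

definition trans_ix :: "nat \<Rightarrow> nat \<Rightarrow> nat \<Rightarrow> nat \<Rightarrow> nat \<Rightarrow> nat" where
  "trans_ix q r n k s = pair (pfst n) (pair (trans_level (pfst (psnd n)))
    (enum_code q r (if pfst (psnd n) = 1 then const_code (pair 0 n) else psnd (psnd n))
      (pair r (pair (trans_level (pfst (psnd n))) (pair k s)))))"

text \<open>A member is built for every \<open>i\<close>, \<open>w\<close> and \<open>z\<close>,
  whether they fit or not: if the conclusions of \<open>w\<close> are not the instantiated atoms,
  the contradictory x_0 \<noteq> x_0 makes the member neutral, as a disjunct of a Sigma formula and,
  negated, as a conjunct of a Pi formula. The tag \<open>pfst (psnd i)\<close> is inherited, so both
  cases share the definition. The \<open>Suc\<close> in \<open>Suc w\<close> keeps x_0 bound even if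
  \<open>k\<close> and \<open>w\<close> are 0.\<close>

definition member_one :: "vocab \<Rightarrow> nat \<Rightarrow> nat \<Rightarrow> nat \<Rightarrow> nat \<Rightarrow> nat \<Rightarrow> nat" where
  "member_one \<tau> i w z k s = pair (range_code k (Suc w)) (pair (pfst (psnd i)) (pair 1
    (if subst_codes (update (pfst i) z s) (psnd (psnd (psnd i))) = psnds w
     then atoms_code \<tau> w (k + Suc w) else consn false_code 0)))"

text \<open>The number \<open>z\<close> codes a pair: how many entries the condition gains, and the
  values of the variables quantified in the original member. The former become quantified variables,
  the latter are absorbed into the environment.\<close>

definition member_step :: "nat \<Rightarrow> nat \<Rightarrow> nat \<Rightarrow> nat \<Rightarrow> nat \<Rightarrow> nat \<Rightarrow> nat" where
  "member_step q r i z k s = pair (range_code k (pfst z))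
    (pair (trans_ix q r (pfst (psnd i)) (k + pfst z) (update (pfst i) (psnd z) s))
      (trans_ix q r (psnd (psnd i)) (k + pfst z) (update (pfst i) (psnd z) s)))"

definition member :: "vocab \<Rightarrow> nat \<Rightarrow> nat \<Rightarrow> nat" where
  "member \<tau> q x = (let i = pfst x; w = pfst (psnd x); z = pfst (psnd (psnd x));
      c = psnd (psnd (psnd x)); r = pfst c; a = pfst (psnd c);
      k = pfst (psnd (psnd c)); s = psnd (psnd (psnd c))
    in if a = 2 then member_one \<tau> i w z k s else member_step q r i z k s)"

lemma computable_trans_ix [computable]:
  assumes "computable_fun r" "computable_fun n" "computable_fun k" "computable_fun s"
  shows "computable_fun (\<lambda>x. trans_ix q (r x) (n x) (k x) (s x))"
  unfolding trans_ix_def trans_level_def by (intro computable assms)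

lemma computable_member:
  assumes "computable_vocab \<tau>" shows "computable_fun (member \<tau> q)"
  unfolding member_def Let_def member_one_def member_step_def by (intro computable assms)

section \<open>Generic bijections\<close>

definition extends :: "(nat \<Rightarrow> nat) \<Rightarrow> nat list \<Rightarrow> bool" where
  "extends f p \<longleftrightarrow> map f [0..<length p] = p"

definition extension :: "nat list \<Rightarrow> nat list \<Rightarrow> bool" (infix "\<sqsubseteq>" 50) where
  "p \<sqsubseteq> q \<longleftrightarrow> distinct q \<and> prefix p q"

definition dense :: "nat list set \<Rightarrow> bool" where
  "dense D \<longleftrightarrow> (\<forall>p. distinct p \<longrightarrow> (\<exists>q\<in>D. p \<sqsubseteq> q))"

definition meets :: "(nat \<Rightarrow> nat) \<Rightarrow> nat list set \<Rightarrow> bool" where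
  "meets f D \<longleftrightarrow> (\<exists>p\<in>D. extends f p)"

text \<open>
  \<open>P\<close> holds on a comeager subset of the space of bijections that extend \<open>p\<close>; conditions
  \<open>p\<close> are lists without repetition, read as initial segments of bijections.
\<close>

definition generically :: "nat list \<Rightarrow> ((nat \<Rightarrow> nat) \<Rightarrow> bool) \<Rightarrow> bool" where
  "generically p P \<longleftrightarrow> (\<exists>\<D>. countable \<D> \<and> (\<forall>D\<in>\<D>. dense D) \<and>
    (\<forall>f. bij f \<and> extends f p \<and> (\<forall>D\<in>\<D>. meets f D) \<longrightarrow> P f))"

lemma extension_refl: "distinct p \<Longrightarrow> p \<sqsubseteq> p"
  by (simp add: extension_def)

lemma extension_trans: "p \<sqsubseteq> q \<Longrightarrow> q \<sqsubseteq> r \<Longrightarrow> p \<sqsubseteq> r"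
  by (auto simp: extension_def)

lemma extends_iff: "extends f p \<longleftrightarrow> (\<forall>i<length p. f i = p ! i)"
  unfolding extends_def list_eq_iff_nth_eq by simp

lemma extends_prefix: "extends f q \<Longrightarrow> prefix p q \<Longrightarrow> extends f p"
  by (auto simp: extends_iff prefix_def nth_append split: if_splits)

lemma extends_comparable:
  assumes "extends f p" "extends f q" shows "prefix p q \<or> prefix q p"
proof -
  have *: "prefix (map f [0..<m]) (map f [0..<n])" if "m \<le> n" for m n
    using that by (metis le_add_diff_inverse map_append prefixI upt_add_eq_append zero_le)
  show ?thesis
    using *[of "length p" "length q"] *[of "length q" "length p"] assms
    unfolding extends_def by (metis nat_le_linear)
qed

text \<open>The Baire category theorem for the space of bijections: stage n enters the n-th dense
  set and then puts n into the range, keeping the tuple injective.\<close>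

lemma generic_exists:
  assumes "distinct p" "countable \<D>" "\<And>D. D \<in> \<D> \<Longrightarrow> dense D"
  obtains f where "bij f" "extends f p" "\<And>D. D \<in> \<D> \<Longrightarrow> meets f D"
proof -
  \<comment> \<open>\<open>from_nat_into\<close> enumerates nonempty sets; the dense set
    \<open>UNIV\<close> is added for that reason.\<close>
  define D where "D = from_nat_into (insert UNIV \<D>)"
  have D: "dense (D n)" for n
  proof -
    have "dense UNIV" by (auto simp: dense_def intro: extension_refl)
    then show ?thesis
      using assms(3) from_nat_into[of "insert UNIV \<D>" n] by (auto simp: D_def)
  qed
  have "\<forall>q n. \<exists>r. distinct q \<longrightarrow> r \<in> D n \<and> q \<sqsubseteq> r"
    using D unfolding dense_def by blast
  then obtain g where g: "\<And>q n. distinct q \<Longrightarrow> g q n \<in> D n \<and> q \<sqsubseteq> g q n"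
    by metis
  define c where "c = rec_nat p (\<lambda>n q. if n \<in> set (g q n) then g q n else g q n @ [n])"
  have c_Suc: "c (Suc n) = (if n \<in> set (g (c n) n) then g (c n) n else g (c n) n @ [n])" for n
    by (simp add: c_def)
  have dist: "distinct (c n)" for n
    by (induction n) (use assms(1) g in \<open>auto simp: c_Suc extension_def, simp add: c_def\<close>)
  have c_step: "prefix (g (c n) n) (c (Suc n))" "prefix (c n) (g (c n) n)" "n \<in> set (c (Suc n))" for n
    using g[OF dist[of n], of n] by (auto simp: c_Suc extension_def)
  have mono: "prefix (c m) (c n)" if "m \<le> n" for m n
    using that
  proof (induction rule: dec_induct)
    case (step n)
    then show ?case using c_step(1,2)[of n] by (meson prefix_order.trans)
  qed simp
  \<comment> \<open>Having 0, ..., n - 1 among its entries forces the tuple to be long, so the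
    domain becomes total without a step of its own.\<close>
  have len: "n \<le> length (c n)" for n
  proof -
    have "{..<n} \<subseteq> set (c n)"
      using c_step(3) mono by (fastforce dest: set_mono_prefix Suc_leI)
    then have "card {..<n} \<le> card (set (c n))" by (intro card_mono) auto
    then show ?thesis using card_length[of "c n"] by simp
  qed
  define f where "f i = c (Suc i) ! i" for i
  have f: "f i = c m ! i" if "i < length (c m)" for i m
  proof -
    have "i < length (c (Suc i))" using len[of "Suc i"] by simp
    then show ?thesis using that mono[of m "Suc i"] mono[of "Suc i" m] nat_le_linear[of m "Suc i"]
      by (auto simp: f_def prefix_def nth_append)
  qed
  then have ext: "extends f (c m)" for m by (simp add: extends_iff)
  show ?thesis
  proof
    have "inj f"
    proof (rule injI)
      fix i j assume "f i = f j"
      define m where "m = Suc (max i j)"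
      have "i < length (c m)" "j < length (c m)" using len[of m] by (auto simp: m_def)
      then show "i = j" using \<open>f i = f j\<close> f dist[of m] by (metis nth_eq_iff_index_eq)
    qed
    moreover have "\<exists>i. f i = n" for n
      using c_step(3)[of n] f[of _ "Suc n"] by (metis in_set_conv_nth)
    ultimately show "bij f" by (metis bijI surjI)
    show "extends f p" using ext[of 0] by (simp add: c_def)
    fix E assume "E \<in> \<D>"
    then obtain n where "D n = E"
      using assms(2) from_nat_into_surj[of "insert UNIV \<D>" E] by (auto simp: D_def)
    then show "meets f E"
      using g[OF dist[of n], of n] extends_prefix[OF ext c_step(1)] by (auto simp: meets_def)
  qed
qed

section \<open>Comeagerness relative to a condition\<close>

lemma generically_False: "distinct p \<Longrightarrow> \<not> generically p (\<lambda>f. False)"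
  unfolding generically_def by (metis generic_exists)

lemma bij_extends: "distinct p \<Longrightarrow> \<exists>f. bij f \<and> extends f p"
  by (metis generic_exists countable_empty empty_iff)

lemma generically_mono:
  assumes "generically p P" "\<And>f. bij f \<Longrightarrow> extends f p \<Longrightarrow> P f \<Longrightarrow> Q f"
  shows "generically p Q"
proof -
  obtain \<D> where "countable \<D> \<and> (\<forall>D\<in>\<D>. dense D) \<and>
    (\<forall>f. bij f \<and> extends f p \<and> (\<forall>D\<in>\<D>. meets f D) \<longrightarrow> P f)"
    using assms(1) unfolding generically_def by (elim exE)
  then show ?thesis unfolding generically_def using assms(2) by (intro exI[of _ \<D>]) simp
qed

lemma generically_extension:
  assumes "generically p P" "p \<sqsubseteq> q" shows "generically q P"
proof -
  obtain \<D> where "countable \<D> \<and> (\<forall>D\<in>\<D>. dense D) \<and>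
    (\<forall>f. bij f \<and> extends f p \<and> (\<forall>D\<in>\<D>. meets f D) \<longrightarrow> P f)"
    using assms(1) unfolding generically_def by (elim exE)
  moreover have "extends f p" if "extends f q" for f
    using that assms(2) by (auto simp: extension_def intro: extends_prefix)
  ultimately show ?thesis unfolding generically_def by (intro exI[of _ \<D>]) simp
qed

lemma generically_always: "(\<And>f. bij f \<Longrightarrow> extends f p \<Longrightarrow> P f) \<Longrightarrow> generically p P"
  unfolding generically_def by (intro exI[of _ "{}"]) auto

lemma generically_all:
  fixes P :: "'i :: countable \<Rightarrow> _"
  assumes "\<And>i. generically p (P i)"
  shows "generically p (\<lambda>f. \<forall>i. P i f)"
proof -
  obtain D where D: "\<And>i. countable (D i) \<and> (\<forall>E\<in>D i. dense E) \<and>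
    (\<forall>f. bij f \<and> extends f p \<and> (\<forall>E\<in>D i. meets f E) \<longrightarrow> P i f)"
    using assms unfolding generically_def by metis
  show ?thesis unfolding generically_def
    by (rule exI[of _ "\<Union>i. D i"]) (use D in \<open>auto; metis\<close>)
qed

lemma generically_conj:
  assumes "generically p P" "generically p Q" shows "generically p (\<lambda>f. P f \<and> Q f)"
proof -
  have "generically p (\<lambda>f. \<forall>b. if b then P f else Q f)"
  proof (rule generically_all)
    show "generically p (\<lambda>f. if b then P f else Q f)" for b
      by (cases b) (simp_all add: assms)
  qed
  then show ?thesis by (rule generically_mono) (metis (full_types))
qed

text \<open>Localization of category: there are only countably many conditions, so the families
  witnessing comeagerness at all of them can be united. One more dense set ensures that a generic
  bijection extends one of these conditions.\<close>

lemma generically_dense: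
  assumes "distinct p" "\<And>q. p \<sqsubseteq> q \<Longrightarrow> \<exists>r. q \<sqsubseteq> r \<and> generically r P"
  shows "generically p P"
proof -
  have "\<forall>q. \<exists>\<D>. generically q P \<longrightarrow> countable \<D> \<and> (\<forall>E\<in>\<D>. dense E) \<and>
    (\<forall>f. bij f \<and> extends f q \<and> (\<forall>E\<in>\<D>. meets f E) \<longrightarrow> P f)"
    unfolding generically_def by blast
  then obtain D where D: "\<And>q. generically q P \<Longrightarrow> countable (D q) \<and> (\<forall>E\<in>D q. dense E) \<and>
    (\<forall>f. bij f \<and> extends f q \<and> (\<forall>E\<in>D q. meets f E) \<longrightarrow> P f)"
    by metis
  \<comment> \<open>Tuples incomparable with \<open>p\<close> are included to make the set dense
    everywhere; no \<open>f\<close> extending \<open>p\<close> extends any of them.\<close>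
  define D0 where "D0 = {q. generically q P \<or> \<not> (prefix p q \<or> prefix q p)}"
  have "dense D0"
    unfolding dense_def
  proof (intro allI impI)
    fix q :: "nat list" assume q: "distinct q"
    consider "prefix p q" | "prefix q p" | "\<not> (prefix p q \<or> prefix q p)" by blast
    then show "\<exists>r\<in>D0. q \<sqsubseteq> r"
    proof cases
      case 1
      then have "p \<sqsubseteq> q" using q by (simp add: extension_def)
      then show ?thesis using assms(2) by (auto simp: D0_def)
    next
      case 2
      then have "q \<sqsubseteq> p" "p \<sqsubseteq> p" using assms(1) by (simp_all add: extension_def)
      then obtain r where "p \<sqsubseteq> r" "generically r P" using assms(2) by blast
      then show ?thesis using extension_trans[OF \<open>q \<sqsubseteq> p\<close>] by (auto simp: D0_def)
    qed (use q in \<open>auto simp: D0_def intro: extension_refl\<close>)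
  qed
  define \<D> where "\<D> = insert D0 (\<Union>q\<in>{q. generically q P}. D q)"
  show ?thesis unfolding generically_def
  proof (intro exI[of _ \<D>] conjI allI impI)
    show "countable \<D>" using D by (auto simp: \<D>_def)
    show "\<forall>E\<in>\<D>. dense E" using D \<open>dense D0\<close> by (auto simp: \<D>_def)
    fix f assume f: "bij f \<and> extends f p \<and> (\<forall>E\<in>\<D>. meets f E)"
    then obtain q where "q \<in> D0" "extends f q" by (auto simp: \<D>_def meets_def)
    then have "generically q P" using f extends_comparable unfolding D0_def by blast
    then show "P f" using f D[of q] \<open>extends f q\<close> by (auto simp: \<D>_def)
  qed
qed

text \<open>The Baire property in forcing form: the conditions that decide \<open>P\<close> up to a
  meager set are dense.\<close>

definition baire :: "((nat \<Rightarrow> nat) \<Rightarrow> bool) \<Rightarrow> bool" where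
  "baire P \<longleftrightarrow> (\<forall>p. distinct p \<longrightarrow> (\<exists>q. p \<sqsubseteq> q \<and> (generically q P \<or> generically q (\<lambda>f. \<not> P f))))"

lemma baire_not: "baire P \<Longrightarrow> baire (\<lambda>f. \<not> P f)"
  unfolding baire_def by auto

lemma baire_const: "baire (\<lambda>f. b)"
  unfolding baire_def by (cases b) (auto intro: extension_refl generically_always)

text \<open>Otherwise the deciding conditions below each extension of \<open>p\<close> would decide
  in favour of \<open>P\<close>, and comeagerness could be patched together at
  \<open>p\<close>.\<close>

lemma baireD:
  assumes "baire P" "distinct p" "\<not> generically p P"
  shows "\<exists>q. p \<sqsubseteq> q \<and> generically q (\<lambda>f. \<not> P f)"
proof (rule ccontr)
  assume *: "\<not> ?thesis"
  have "generically p P"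
  proof (rule generically_dense[OF assms(2)])
    fix q assume q: "p \<sqsubseteq> q"
    then obtain r where "q \<sqsubseteq> r" "generically r P \<or> generically r (\<lambda>f. \<not> P f)"
      using assms(1) unfolding baire_def extension_def by blast
    then show "\<exists>r. q \<sqsubseteq> r \<and> generically r P" using * q extension_trans by blast
  qed
  then show False using assms(3) by simp
qed

text \<open>Either some \<open>P i\<close> is comeager below an extension, or each
  \<open>P i\<close> is meager below \<open>p\<close>, and then so is the countable union.\<close>

lemma baire_Ex:
  fixes P :: "'i :: countable \<Rightarrow> _"
  assumes "\<And>i. baire (P i)" shows "baire (\<lambda>f. \<exists>i. P i f)"
  unfolding baire_def
proof (intro allI impI)
  fix p :: "nat list" assume p: "distinct p"
  show "\<exists>q. p \<sqsubseteq> q \<and> (generically q (\<lambda>f. \<exists>i. P i f) \<or> generically q (\<lambda>f. \<not> (\<exists>i. P i f)))"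
  proof (cases "\<exists>q i. p \<sqsubseteq> q \<and> generically q (P i)")
    case True
    then show ?thesis by (metis (mono_tags, lifting) generically_mono)
  next
    case False
    have "generically p (\<lambda>f. \<not> P i f)" for i
      using False baireD[OF baire_not[OF assms[of i]] p] by auto
    then have "generically p (\<lambda>f. \<forall>i. \<not> P i f)" by (rule generically_all)
    then show ?thesis using p by (auto intro: extension_refl)
  qed
qed

lemma baire_All:
  fixes P :: "'i :: countable \<Rightarrow> _"
  assumes "\<And>i. baire (P i)" shows "baire (\<lambda>f. \<forall>i. P i f)"
  using baire_not[OF baire_Ex[OF baire_not[OF assms]]] by simp

lemma baire_disj:
  assumes "baire P" "baire Q" shows "baire (\<lambda>f. P f \<or> Q f)"
proof -
  have "baire (\<lambda>f. \<exists>b. if b then P f else Q f)"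
  proof (rule baire_Ex)
    show "baire (\<lambda>f. if b then P f else Q f)" for b by (cases b) (simp_all add: assms)
  qed
  then show ?thesis by (simp add: ex_bool_eq)
qed

lemma baire_conj: "baire P \<Longrightarrow> baire Q \<Longrightarrow> baire (\<lambda>f. P f \<and> Q f)"
  using baire_not[OF baire_disj[OF baire_not baire_not]] by simp

section \<open>Open sets of functions\<close>

definition finitely_determined :: "((nat \<Rightarrow> nat) \<Rightarrow> bool) \<Rightarrow> bool" where
  "finitely_determined P \<longleftrightarrow> (\<forall>f. P f \<longrightarrow> (\<exists>m. \<forall>g. (\<forall>i<m. g i = f i) \<longrightarrow> P g))"

text \<open>A bijection satisfies an open \<open>P\<close> by virtue of an initial segment. Below
  that segment \<open>P\<close> always holds, and by the Baire category theorem such a neighbourhood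
  is not meager.\<close>

lemma not_generically_open_iff:
  assumes "finitely_determined P" "distinct p"
  shows "\<not> generically p (\<lambda>f. \<not> P f) \<longleftrightarrow> (\<exists>f. bij f \<and> extends f p \<and> P f)"
proof
  assume "\<exists>f. bij f \<and> extends f p \<and> P f"
  then obtain f where f: "bij f" "extends f p" "P f" by blast
  then obtain m where m: "\<And>g. \<forall>i<m. g i = f i \<Longrightarrow> P g"
    using assms(1) unfolding finitely_determined_def by blast
  \<comment> \<open>Long enough to extend \<open>p\<close> and to cover the \<open>m\<close> values
    on which \<open>P f\<close> depends.\<close>
  define q where "q = map f [0..<length p + m]"
  have "distinct q" using f(1) by (auto simp: q_def distinct_map bij_def inj_on_def)
  moreover have "prefix p q" using f(2) unfolding extends_def q_def
    by (metis map_append prefixI upt_add_eq_append zero_le)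
  ultimately have "p \<sqsubseteq> q" by (simp add: extension_def)
  moreover have "P g" if "extends g q" for g
    using that by (intro m) (auto simp: extends_iff q_def)
  moreover have "generically q (\<lambda>f. False)" if "generically p (\<lambda>f. \<not> P f)"
    using generically_extension[OF that \<open>p \<sqsubseteq> q\<close>] by (rule generically_mono) (use calculation in auto)
  ultimately show "\<not> generically p (\<lambda>f. \<not> P f)" using generically_False \<open>distinct q\<close> by blast
qed (auto intro: generically_always)

lemma baire_open:
  assumes "finitely_determined P" shows "baire P"
  unfolding baire_def
proof (intro allI impI)
  fix p :: "nat list" assume p: "distinct p"
  show "\<exists>q. p \<sqsubseteq> q \<and> (generically q P \<or> generically q (\<lambda>f. \<not> P f))"
  proof (cases "\<exists>f. bij f \<and> extends f p \<and> P f")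
    case True
    then obtain f where f: "bij f" "extends f p" "P f" by blast
    then obtain m where m: "\<And>g. \<forall>i<m. g i = f i \<Longrightarrow> P g"
      using assms(1) unfolding finitely_determined_def by blast
    define q where "q = map f [0..<length p + m]"
    have "distinct q" using f(1) by (auto simp: q_def distinct_map bij_def inj_on_def)
    moreover have "prefix p q" using f(2) unfolding extends_def q_def
      by (metis map_append prefixI upt_add_eq_append zero_le)
    moreover have "generically q P"
      by (rule generically_always, rule m) (auto simp: extends_iff q_def)
    ultimately show ?thesis by (auto simp: extension_def)
  next
    case False
    then show ?thesis using p by (intro exI[of _ p]) (auto intro: extension_refl generically_always)
  qed
qed

text \<open>If the right side fails, then wherever \<open>P i\<close> is nonmeager,
  \<open>Q i\<close> is not comeager, so by the Baire property its complement is comeager below some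
  extension. Hence each conjunction is meager below \<open>p\<close>, and so is the countable union
  of all of them.\<close>

lemma not_generically_Ex_iff:
  fixes P Q :: "'i :: countable \<Rightarrow> _"
  assumes "\<And>i. baire (Q i)" "distinct p"
  shows "\<not> generically p (\<lambda>f. \<not> (\<exists>i. P i f \<and> Q i f)) \<longleftrightarrow>
    (\<exists>q i. p \<sqsubseteq> q \<and> \<not> generically q (\<lambda>f. \<not> P i f) \<and> generically q (Q i))" (is "?L \<longleftrightarrow> ?R")
proof
  assume ?R
  then obtain q i where q: "p \<sqsubseteq> q" "\<not> generically q (\<lambda>f. \<not> P i f)" "generically q (Q i)" by blast
  show ?L
  proof
    assume "generically p (\<lambda>f. \<not> (\<exists>i. P i f \<and> Q i f))"
    from generically_conj[OF generically_extension[OF this q(1)] q(3)]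
    have "generically q (\<lambda>f. \<not> P i f)" by (rule generically_mono) blast
    then show False using q(2) by simp
  qed
next
  assume ?L
  show ?R
  proof (rule ccontr)
    assume R: "\<not> ?R"
    have "generically p (\<lambda>f. \<not> (P i f \<and> Q i f))" for i
    proof (rule generically_dense[OF assms(2)])
      fix q assume q: "p \<sqsubseteq> q"
      show "\<exists>r. q \<sqsubseteq> r \<and> generically r (\<lambda>f. \<not> (P i f \<and> Q i f))"
      proof (cases "generically q (\<lambda>f. \<not> P i f)")
        case True
        then have "generically q (\<lambda>f. \<not> (P i f \<and> Q i f))" by (rule generically_mono) blast
        then show ?thesis using q extension_def extension_refl by blast
      next
        case False
        then have "\<not> generically q (Q i)" using R q by blast
        then obtain r where r: "q \<sqsubseteq> r" "generically r (\<lambda>f. \<not> Q i f)"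
          using baireD[OF assms(1)] q extension_def by blast
        from r(2) have "generically r (\<lambda>f. \<not> (P i f \<and> Q i f))" by (rule generically_mono) blast
        then show ?thesis using r(1) by blast
      qed
    qed
    then have "generically p (\<lambda>f. \<forall>i. \<not> (P i f \<and> Q i f))" by (rule generically_all)
    then show False using \<open>?L\<close> by simp
  qed
qed

text \<open>The negated form of the equivalence for disjunctions with the roles exchanged: the
  negation of \<open>Q\<close> is the nonmeager part, that of \<open>P\<close> the comeager
  one.\<close>

lemma generically_All_iff:
  fixes P Q :: "'i :: countable \<Rightarrow> _"
  assumes "\<And>i. baire (P i)" "distinct p"
  shows "generically p (\<lambda>f. \<forall>i. P i f \<or> Q i f) \<longleftrightarrow>
    (\<forall>q i. p \<sqsubseteq> q \<longrightarrow> \<not> generically q (\<lambda>f. \<not> P i f) \<or> generically q (Q i))"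
proof -
  have "\<not> generically p (\<lambda>f. \<not> (\<exists>i. \<not> Q i f \<and> \<not> P i f)) \<longleftrightarrow>
    (\<exists>q i. p \<sqsubseteq> q \<and> \<not> generically q (Q i) \<and> generically q (\<lambda>f. \<not> P i f))"
    using not_generically_Ex_iff[of "\<lambda>i f. \<not> P i f" p "\<lambda>i f. \<not> Q i f", OF baire_not[OF assms(1)] assms(2)]
    by (simp only: not_not)
  moreover have eq: "(\<lambda>f. \<forall>i. P i f \<or> Q i f) = (\<lambda>f. \<not> (\<exists>i. \<not> Q i f \<and> \<not> P i f))" by auto
  ultimately show ?thesis unfolding eq by blast
qed

section \<open>Satisfaction\<close>

lemma atom_sat_cong: "(\<And>x. x \<in> atom_vars \<alpha> \<Longrightarrow> s x = t x) \<Longrightarrow> atom_sat A s \<alpha> = atom_sat A t \<alpha>"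
  by (cases \<alpha>) (auto cong: map_cong)

lemma sat_cong: "(\<And>x. x \<in> FV \<phi> \<Longrightarrow> s x = t x) \<Longrightarrow> sat A \<phi> s = sat A \<phi> t"
proof (induction \<phi> arbitrary: s t)
  case (Conj0 \<alpha>s)
  then have "atom_sat A s \<alpha> = atom_sat A t \<alpha>" if "\<alpha> \<in> set \<alpha>s" for \<alpha>
    using that by (intro atom_sat_cong) auto
  then show ?case by simp
next
  case (Disj0 \<alpha>s)
  then have "atom_sat A s \<alpha> = atom_sat A t \<alpha>" if "\<alpha> \<in> set \<alpha>s" for \<alpha>
    using that by (intro atom_sat_cong) auto
  then show ?case by simp
next
  case (And \<phi> \<psi>)
  have "sat A \<phi> s = sat A \<phi> t" "sat A \<psi> s = sat A \<psi> t"
    using And.prems by (auto intro!: And.IH)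
  then show ?case by simp
next
  case (Or \<phi> \<psi>)
  have "sat A \<phi> s = sat A \<phi> t" "sat A \<psi> s = sat A \<psi> t"
    using Or.prems by (auto intro!: Or.IH)
  then show ?case by simp
next
  case (BigOr I F)
  have "sat A (F i) s = sat A (F i) t" if "i \<in> I" for i
    using BigOr.prems that by (intro BigOr.IH) auto
  then show ?case by simp
next
  case (BigAnd I F)
  have "sat A (F i) s = sat A (F i) t" if "i \<in> I" for i
    using BigAnd.prems that by (intro BigAnd.IH) auto
  then show ?case by simp
next
  case (Exs xs \<phi>)
  have *: "sat A (Exs xs \<phi>) t" if "sat A (Exs xs \<phi>) s" "\<And>x. x \<in> FV \<phi> - set xs \<Longrightarrow> s x = t x" for s t
  proof -
    from that(1) obtain s' where s': "\<forall>x. x \<notin> set xs \<longrightarrow> s' x = s x" "sat A \<phi> s'" by auto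
    have "sat A \<phi> s' = sat A \<phi> (\<lambda>x. if x \<in> set xs then s' x else t x)"
      using s'(1) that(2) by (intro Exs.IH) auto
    then show ?thesis using s'(2) by (auto intro!: exI[of _ "\<lambda>x. if x \<in> set xs then s' x else t x"])
  qed
  show ?case using *[of s t] *[of t s] Exs.prems by fastforce
next
  case (Alls xs \<phi>)
  have *: "sat A (Alls xs \<phi>) s" if "sat A (Alls xs \<phi>) t" "\<And>x. x \<in> FV \<phi> - set xs \<Longrightarrow> s x = t x" for s t
    unfolding sat.simps
  proof (intro allI impI)
    fix s' assume s': "\<forall>x. x \<notin> set xs \<longrightarrow> s' x = s x"
    have "sat A \<phi> s' = sat A \<phi> (\<lambda>x. if x \<in> set xs then s' x else t x)"
      using s' that(2) by (intro Alls.IH) auto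
    then show "sat A \<phi> s'" using that(1) by simp
  qed
  show ?case using *[of s t] *[of t s] Alls.prems by fastforce
qed

lemma sat_sentence: "sentence \<phi> \<Longrightarrow> sat A \<phi> s = sat A \<phi> t"
  by (rule sat_cong) (simp add: sentence_def)

lemma models_sentence: "sentence \<phi> \<Longrightarrow> A \<Turnstile> \<phi> \<longleftrightarrow> sat A \<phi> s"
  unfolding models_def using sat_sentence by blast

lemma sat_iso:
  assumes "bij h" "\<And>r xs. xs \<in> A r \<longleftrightarrow> map h xs \<in> B r"
  shows "sat A \<phi> s = sat B \<phi> (\<lambda>x. h (s x))"
proof (induction \<phi> arbitrary: s)
  have atom: "atom_sat A s \<alpha> = atom_sat B (\<lambda>x. h (s x)) \<alpha>" for s \<alpha>
    using assms by (cases \<alpha>) (auto simp: bij_def inj_eq comp_def)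
  have ex: "(\<exists>t. (\<forall>x. x \<notin> set xs \<longrightarrow> t x = s x) \<and> P (\<lambda>x. h (t x))) \<longleftrightarrow>
    (\<exists>t. (\<forall>x. x \<notin> set xs \<longrightarrow> t x = h (s x)) \<and> P t)" for xs s and P :: "(nat \<Rightarrow> nat) \<Rightarrow> bool"
  proof
    assume "\<exists>t. (\<forall>x. x \<notin> set xs \<longrightarrow> t x = h (s x)) \<and> P t"
    then obtain t where t: "\<forall>x. x \<notin> set xs \<longrightarrow> t x = h (s x)" "P t" by blast
    then have "\<forall>x. x \<notin> set xs \<longrightarrow> inv h (t x) = s x" "(\<lambda>x. h (inv h (t x))) = t"
      using assms(1) by (auto simp: bij_def surj_f_inv_f)
    then show "\<exists>t. (\<forall>x. x \<notin> set xs \<longrightarrow> t x = s x) \<and> P (\<lambda>x. h (t x))"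
      using t(2) by (intro exI[of _ "\<lambda>x. inv h (t x)"]) simp
  next
    assume "\<exists>t. (\<forall>x. x \<notin> set xs \<longrightarrow> t x = s x) \<and> P (\<lambda>x. h (t x))"
    then obtain t where "\<forall>x. x \<notin> set xs \<longrightarrow> t x = s x" "P (\<lambda>x. h (t x))" by blast
    then show "\<exists>t. (\<forall>x. x \<notin> set xs \<longrightarrow> t x = h (s x)) \<and> P t"
      by (intro exI[of _ "\<lambda>x. h (t x)"]) simp
  qed
  {
    case (Conj0 x) then show ?case by (simp add: atom)
  next
    case (Disj0 x) then show ?case by (simp add: atom)
  next
    case (Exs xs \<phi>)
    then show ?case using ex[of xs s "sat B \<phi>"] by simp
  next
    case (Alls xs \<phi>)
    show ?case unfolding sat.simps Alls.IH using ex[of xs s "\<lambda>t. \<not> sat B \<phi> t"] by blast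
  }
qed auto

text \<open>A bijection \<open>f\<close> is an isomorphism from this copy onto \<open>A\<close>: the
  number i of the copy stands for the element \<open>f i\<close>. A condition thus lists the
  elements of \<open>A\<close> named by 0, 1, and so on.\<close>

definition pull :: "(nat \<Rightarrow> nat) \<Rightarrow> struct \<Rightarrow> struct" where
  "pull f A r = {xs. map f xs \<in> A r}"

lemma pull_in_K:
  assumes "iso_closed \<tau> K" "K \<subseteq> Mod \<tau>" "A \<in> K" "bij f"
  shows "pull f A \<in> K" "A \<cong> pull f A"
proof -
  have "map f (map (inv f) xs) = xs" for xs
    using assms(4) by (simp add: bij_def surj_iff)
  then have "xs \<in> A r \<longleftrightarrow> map (inv f) xs \<in> pull f A r" for r xs
    by (simp add: pull_def del: map_map)
  then show iso: "A \<cong> pull f A" unfolding iso_def using assms(4) bij_imp_bij_inv by blast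
  have "pull f A \<in> Mod \<tau>" using assms(2,3) by (fastforce simp: Mod_def pull_def)
  then show "pull f A \<in> K" using assms(1,3) iso unfolding iso_closed_def by blast
qed

lemma models_iso: "A \<cong> B \<Longrightarrow> sentence \<phi> \<Longrightarrow> sat A \<phi> s = sat B \<phi> t"
  unfolding iso_def using sat_iso sat_sentence by metis

lemma atom_code_mem_diag_pull:
  "bij f \<Longrightarrow> atom_code \<alpha> \<in> diag (pull f A) \<longleftrightarrow> atom_sat A f \<alpha>"
  unfolding atom_code_mem_diag by (cases \<alpha>) (auto simp: pull_def bij_def inj_eq)

section \<open>Topological complexity of truth in the images\<close>

lemma finitely_determined_Ex:
  "(\<And>i. finitely_determined (P i)) \<Longrightarrow> finitely_determined (\<lambda>f. \<exists>i. P i f)"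
  unfolding finitely_determined_def by meson

lemma finitely_determined_const: "finitely_determined (\<lambda>f. b)"
  by (simp add: finitely_determined_def)

lemma finitely_determined_conj:
  assumes "finitely_determined P" "finitely_determined Q"
  shows "finitely_determined (\<lambda>f. P f \<and> Q f)"
  unfolding finitely_determined_def
proof (intro allI impI)
  fix f assume "P f \<and> Q f"
  then obtain m n where "\<forall>g. (\<forall>i<m. g i = f i) \<longrightarrow> P g" "\<forall>g. (\<forall>i<n. g i = f i) \<longrightarrow> Q g"
    using assms unfolding finitely_determined_def by blast
  then show "\<exists>m. \<forall>g. (\<forall>i<m. g i = f i) \<longrightarrow> P g \<and> Q g"
    by (intro exI[of _ "max m n"]) simp
qed

lemma finitely_determined_Ball:
  "(\<And>i. i \<in> set xs \<Longrightarrow> finitely_determined (P i)) \<Longrightarrow> finitely_determined (\<lambda>f. \<forall>i\<in>set xs. P i f)"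
  by (induction xs) (simp_all add: finitely_determined_const finitely_determined_conj)

lemma finitely_determined_diag: "finitely_determined (\<lambda>f. set_decode v \<subseteq> diag (pull f A))"
proof -
  have "finitely_determined (\<lambda>f. atom_code \<alpha> \<in> diag (pull f A))" for \<alpha>
    unfolding finitely_determined_def
  proof (intro allI impI)
    fix f assume f: "atom_code \<alpha> \<in> diag (pull f A)"
    have "atom_code \<alpha> \<in> diag (pull g A)" if g: "\<forall>i<Suc (atom_code \<alpha>). g i = f i" for g
    proof (cases \<alpha>)
      case (Rel r xs)
      then have eq: "map g xs = map f xs" using g atom_vars_le[of _ \<alpha>] by (auto simp: less_Suc_eq_le)
      show ?thesis using f unfolding atom_code_mem_diag Rel
        by (simp add: pull_def eq del: map_eq_conv)
    qed (use f in \<open>simp_all add: atom_code_mem_diag del: atom_code.simps\<close>)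
    then show "\<exists>m. \<forall>g. (\<forall>i<m. g i = f i) \<longrightarrow> atom_code \<alpha> \<in> diag (pull g A)" by blast
  qed
  from this[of "atom_of c" for c]
  have "finitely_determined (\<lambda>f. \<forall>c\<in>set (list_decode (bits v)). c \<in> diag (pull f A))"
    by (intro finitely_determined_Ball) simp
  then show ?thesis by (simp add: set_bits subset_iff Ball_def)
qed

text \<open>Enumeration operators are continuous: one axiom with a finite premise puts an atom into
  the image. Equalities and inequalities do not depend on \<open>f\<close>.\<close>

lemma finitely_determined_atom: "finitely_determined (\<lambda>f. atom_sat (op_struct e (pull f A)) s \<alpha>)"
proof (cases \<alpha>)
  case (Rel r xs)
  have "finitely_determined (\<lambda>f. \<exists>v. pair v m \<in> W e \<and> set_decode v \<subseteq> diag (pull f A))" for m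
    by (intro finitely_determined_Ex finitely_determined_conj finitely_determined_const
        finitely_determined_diag)
  then show ?thesis by (simp add: Rel op_struct_def struct_of_def enum_op_def)
qed (simp_all add: finitely_determined_const)

text \<open>With quantifiers over assignments rewritten as quantifiers over numbers, only countable
  connectives remain, and these preserve the Baire property.\<close>

lemma baire_sat: "baire (\<lambda>f. sat (op_struct e (pull f A)) \<phi> s)"
proof (induction \<phi> arbitrary: s)
  case (Conj0 \<alpha>s)
  show ?case unfolding sat.simps
    by (intro baire_open finitely_determined_Ball finitely_determined_atom)
next
  case (Disj0 \<alpha>s)
  have "baire (\<lambda>f. \<not> (\<forall>\<alpha>\<in>set \<alpha>s. atom_sat (op_struct e (pull f A)) s \<alpha>))"
    by (intro baire_not baire_open finitely_determined_Ball finitely_determined_atom)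
  then show ?case by simp
next
  case (And \<phi> \<psi>) then show ?case by (simp add: baire_conj)
next
  case (Or \<phi> \<psi>) then show ?case by (simp add: baire_disj)
next
  case (BigOr I F)
  have eq: "sat B (BigOr I F) s \<longleftrightarrow> (\<exists>i. i \<in> I \<and> sat B (F i) s)" for B by auto
  show ?case unfolding eq by (intro baire_Ex baire_conj baire_const BigOr.IH) simp
next
  case (BigAnd I F)
  have eq: "sat B (BigAnd I F) s \<longleftrightarrow> (\<forall>i. i \<notin> I \<or> sat B (F i) s)" for B by auto
  show ?case unfolding eq by (intro baire_All baire_disj baire_const BigAnd.IH) simp
next
  case (Exs xs \<phi>)
  show ?case unfolding sat.simps ex_override_iff by (intro baire_Ex Exs.IH)
next
  case (Alls xs \<phi>)
  have eq: "sat B (Alls xs \<phi>) s \<longleftrightarrow> (\<forall>l. sat B \<phi> (\<lambda>x. if x \<in> set xs then lookup l x else s x))" for B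
    using ex_override_iff[of xs s "\<lambda>t. \<not> sat B \<phi> t"] by auto
  show ?case unfolding eq by (intro baire_All Alls.IH)
qed

section \<open>Indices\<close>

inductive_cases kleene_O_E: "kleene_O a"
inductive_cases less_O_E: "less_O b a"

lemma not_kleene_O_0: "\<not> kleene_O 0"
  by (auto elim: kleene_O_E)

lemma not_less_O_0: "\<not> less_O b 0"
proof
  assume "less_O b 0" then show False by (rule less_O_E) simp_all
qed

lemma not_less_O_1: "\<not> less_O b (Suc 0)"
proof
  have 1: "a = 0" if "Suc 0 = 2 ^ a" for a
    using that by (cases a) auto
  have 2: "3 * 5 ^ e \<noteq> Suc 0" for e
    using one_le_power[of "5::nat" e] by linarith
  assume "less_O b (Suc 0)"
  then show False
    by (rule less_O_E) (use 1 2 not_less_O_0 not_kleene_O_0 in metis)+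
qed

lemma not_less_O_2_2: "\<not> less_O 2 2"
proof
  have 1: "a = 1" if "(2::nat) = 2 ^ a" for a
    using that power_inject_exp[of "2::nat" 1 a] by simp
  have 2: "3 * 5 ^ e \<noteq> (2::nat)" for e
    using one_le_power[of "5::nat" e] by linarith
  assume "less_O 2 2"
  then show False
    by (rule less_O_E) (use 1 2 not_less_O_1 in \<open>metis One_nat_def n_not_Suc_n numeral_2_eq_2\<close>)+
qed

text \<open>Separates the clauses for levels above 1 from those for levels 0 and 1 when an index is
  inverted. \<open>Suc 0\<close> is listed because the simplifier turns \<open>1\<close> into
  it.\<close>

lemma less_O_2_neq: "less_O 2 a \<Longrightarrow> a \<noteq> 1 \<and> a \<noteq> 2 \<and> a \<noteq> Suc 0"
  using not_less_O_1[of 2] not_less_O_2_2 by (metis One_nat_def)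

inductive_cases Sigma_pc_E: "Sigma_pc \<tau> a n \<phi>"
inductive_cases Pi_pc_E: "Pi_pc \<tau> a n \<phi>"

lemma Sigma_pc_1E:
  "Sigma_pc \<tau> 1 n \<phi> \<Longrightarrow> \<exists>\<alpha>s. n = Sigma_ix 1 (list_encode (map atom_code \<alpha>s)) \<and> \<phi> = Conj0 \<alpha>s"
  by (auto elim!: Sigma_pc_E dest: less_O_2_neq)

lemma Pi_pc_1E:
  "Pi_pc \<tau> 1 n \<phi> \<Longrightarrow> \<exists>\<alpha>s. n = Pi_ix 1 (list_encode (map atom_code \<alpha>s)) \<and> \<phi> = Disj0 \<alpha>s"
  by (auto elim!: Pi_pc_E dest: less_O_2_neq)

text \<open>
  An index does not determine the formula, since the values of a family outside its index set
  are arbitrary, but it determines the meaning.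
\<close>

lemma
  shows Sigma_pc_unique: "Sigma_pc \<tau> a n \<phi> \<Longrightarrow> Sigma_pc \<tau> b n \<psi> \<Longrightarrow> sat A \<phi> s = sat A \<psi> s"
    and Pi_pc_unique: "Pi_pc \<tau> a n \<phi> \<Longrightarrow> Pi_pc \<tau> b n \<psi> \<Longrightarrow> sat A \<phi> s = sat A \<psi> s"
proof (induction arbitrary: b \<psi> s and b \<psi> s rule: Sigma_pc_Pi_pc.inducts)
  case (Sigma_zero \<alpha>s)
  from Sigma_zero(2) show ?case
    by (rule Sigma_pc_E) (auto simp: Sigma_ix_def list_encode_eq inj_map_eq_map[OF inj_atom_code] dest: less_O_2_neq)
next
  case (Pi_zero \<alpha>s)
  from Pi_zero(2) show ?case
    by (rule Pi_pc_E) (auto simp: Pi_ix_def list_encode_eq inj_map_eq_map[OF inj_atom_code] dest: less_O_2_neq)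
next
  case (Sigma_one e G)
  from Sigma_one(2) show ?case
  proof (rule Sigma_pc_E)
    fix e' G' assume *: "b = 2" "Sigma_ix 2 e = Sigma_ix 2 e'"
      "\<psi> = BigOr (W e') (\<lambda>i. Exs (mem_vars i) (G' i))" "\<forall>i\<in>W e'. Sigma_pc \<tau> (Suc 0) (mem_ix i) (G' i)"
    then have "sat A (G i) t = sat A (G' i) t" if "i \<in> W e" for i t
      using Sigma_one(1) that by (auto simp: Sigma_ix_def)
    then show ?thesis using * by (simp add: Sigma_ix_def)
  qed (auto simp: Sigma_ix_def dest: less_O_2_neq)
next
  case (Pi_one e G)
  from Pi_one(2) show ?case
  proof (rule Pi_pc_E)
    fix e' G' assume *: "b = 2" "Pi_ix 2 e = Pi_ix 2 e'"
      "\<psi> = BigAnd (W e') (\<lambda>i. Alls (mem_vars i) (G' i))" "\<forall>i\<in>W e'. Pi_pc \<tau> (Suc 0) (mem_ix i) (G' i)"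
    then have "sat A (G i) t = sat A (G' i) t" if "i \<in> W e" for i t
      using Pi_one(1) that by (auto simp: Pi_ix_def)
    then show ?thesis using * by (simp add: Pi_ix_def)
  qed (auto simp: Pi_ix_def dest: less_O_2_neq)
next
  case (Sigma_step a e F G)
  from Sigma_step(3) show ?case
  proof (rule Sigma_pc_E)
    fix e' F' G' assume *: "Sigma_ix a e = Sigma_ix b e'"
      "\<psi> = BigOr (W e') (\<lambda>i. Exs (mem_vars i) (And (F' i) (G' i)))"
      "\<forall>i\<in>W e'. \<exists>c. less_O c b \<and> Sigma_pc \<tau> c (mem_Sigma i) (F' i) \<and> Pi_pc \<tau> c (mem_Pi i) (G' i)"
    then have "sat A (F i) t = sat A (F' i) t \<and> sat A (G i) t = sat A (G' i) t" if "i \<in> W e" for i t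
      using Sigma_step(2) that unfolding Sigma_ix_def by (metis Pair_inject prod_encode_eq)
    then show ?thesis using * by (simp add: Sigma_ix_def)
  qed (use Sigma_step(1) in \<open>auto simp: Sigma_ix_def dest: less_O_2_neq\<close>)
next
  case (Pi_step a e F G)
  from Pi_step(3) show ?case
  proof (rule Pi_pc_E)
    fix e' F' G' assume *: "Pi_ix a e = Pi_ix b e'"
      "\<psi> = BigAnd (W e') (\<lambda>i. Alls (mem_vars i) (Or (F' i) (G' i)))"
      "\<forall>i\<in>W e'. \<exists>c. less_O c b \<and> Sigma_pc \<tau> c (mem_Sigma i) (F' i) \<and> Pi_pc \<tau> c (mem_Pi i) (G' i)"
    then have "sat A (F i) t = sat A (F' i) t \<and> sat A (G i) t = sat A (G' i) t" if "i \<in> W e" for i t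
      using Pi_step(2) that unfolding Pi_ix_def by (metis Pair_inject prod_encode_eq)
    then show ?thesis using * by (simp add: Pi_ix_def)
  qed (use Pi_step(1) in \<open>auto simp: Pi_ix_def dest: less_O_2_neq\<close>)
qed

section \<open>The translation\<close>

text \<open>The link between syntax and forcing: quantified new variables with distinct values are
  the new entries of a longer condition.\<close>

lemma extension_reindex:
  "(\<exists>m t. (\<forall>x. x \<notin> {k..<k + m} \<longrightarrow> t x = \<sigma> x) \<and> distinct (map t [0..<k + m]) \<and> R m (map t [0..<k + m])) \<longleftrightarrow>
    (\<exists>q. map \<sigma> [0..<k] \<sqsubseteq> q \<and> R (length q - k) q)" (is "?L \<longleftrightarrow> ?R")
proof
  assume ?L
  then obtain m t where t: "\<forall>x. x \<notin> {k..<k + m} \<longrightarrow> t x = \<sigma> x" "distinct (map t [0..<k + m])"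
    "R m (map t [0..<k + m])" by blast
  have "map t [0..<k + m] = map t [0..<k] @ map t [k..<k + m]"
    by (metis map_append upt_add_eq_append zero_le)
  moreover have "map t [0..<k] = map \<sigma> [0..<k]" using t(1) by simp
  ultimately have "map \<sigma> [0..<k] \<sqsubseteq> map t [0..<k + m]" using t(2) by (simp add: extension_def)
  then show ?R using t(3) by (intro exI[of _ "map t [0..<k + m]"]) simp
next
  assume ?R
  then obtain q where q: "distinct q" "prefix (map \<sigma> [0..<k]) q" "R (length q - k) q"
    by (auto simp: extension_def)
  define t where "t x = (if x < length q then q ! x else \<sigma> x)" for x
  have len: "k \<le> length q" using prefix_length_le[OF q(2)] by simp
  have "q ! x = \<sigma> x" if "x < k" for x
    using q(2) that by (auto simp: prefix_def nth_append)
  then have "\<forall>x. x \<notin> {k..<k + (length q - k)} \<longrightarrow> t x = \<sigma> x" using len by (auto simp: t_def)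
  moreover have "map t [0..<k + (length q - k)] = q"
    using len by (intro nth_equalityI) (auto simp: t_def)
  ultimately show ?L using q(1,3) by metis
qed

lemma ex_pair_iff:
  "(\<exists>i z. P i \<and> R i (pfst z) (psnd z)) \<longleftrightarrow> (\<exists>i u. P i \<and> (\<exists>m. R i m u))"
proof -
  have "(\<exists>z. R i (pfst z) (psnd z)) \<longleftrightarrow> (\<exists>u m. R i m u)" for i
    by (metis fst_conv prod_encode_inverse snd_conv)
  then show ?thesis by blast
qed

text \<open>Collects what the effective part provides: \<open>q\<close> enumerates the finite lists
  of axioms, and the code of \<open>T\<close> is what gets supplied for the parameter
  \<open>r\<close>.\<close>

locale enum_embedding =
  fixes \<tau> \<tau>' :: vocab and K K' :: "struct set" and e q :: nat and T :: prog
  assumes K: "K \<subseteq> Mod \<tau>" "iso_closed \<tau> K"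
    and emb: "computable_embedding e K K'"
    and W_q: "W q = {w. set (list_decode w) \<subseteq> W e}"
    and T: "\<And>x y. eval T x y \<longleftrightarrow> y = member \<tau> q x"
begin

abbreviation trans :: "nat \<Rightarrow> nat \<Rightarrow> nat \<Rightarrow> nat" where
  "trans n k s \<equiv> trans_ix q (prog_code T) n k s"

abbreviation members :: "nat \<Rightarrow> nat \<Rightarrow> nat \<Rightarrow> nat \<Rightarrow> nat" where
  "members d a k s \<equiv> enum_code q (prog_code T) d (pair (prog_code T) (pair a (pair k s)))"

abbreviation image_sat :: "struct \<Rightarrow> fml \<Rightarrow> (nat \<Rightarrow> nat) \<Rightarrow> (nat \<Rightarrow> nat) \<Rightarrow> bool" where
  "image_sat A \<phi> t f \<equiv> sat (op_struct e (pull f A)) \<phi> t"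

lemma W_members_one:
  "W (members d 2 k s) = {member_one \<tau> i w z k s | i w z. i \<in> W d \<and> set (list_decode w) \<subseteq> W e}"
  by (simp add: W_enum_code[OF T] member_def Let_def W_q)

lemma W_members_step:
  assumes "a \<noteq> 2"
  shows "W (members d a k s) = {member_step q (prog_code T) i z k s | i z. i \<in> W d}"
proof -
  \<comment> \<open>The enumeration also ranges over axiom lists, which the step members ignore; the
    empty list shows that one can always be supplied.\<close>
  have "0 \<in> W q" by (simp add: W_q)
  then show ?thesis using assms by (auto simp: W_enum_code[OF T] member_def Let_def)
qed

text \<open>One axiom per atom suffices, and these finitely many axioms form a list aligned with the
  atoms.\<close>

lemma image_atoms_sat:
  assumes "B \<in> K"
  shows "(\<forall>\<alpha>\<in>set \<alpha>s. atom_sat (op_struct e B) t \<alpha>) \<longleftrightarrow>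
    (\<exists>w. set (list_decode w) \<subseteq> W e \<and>
      map psnd (list_decode w) = map (\<lambda>\<alpha>. atom_code (subst_atom t \<alpha>)) \<alpha>s \<and>
      (\<forall>z\<in>set (list_decode w). set_decode (pfst z) \<subseteq> diag B))" (is "?L \<longleftrightarrow> ?R")
proof -
  \<comment> \<open>\<open>op_struct\<close> retains only the relational part of the output. Since
    the output is a full diagram, the enumerated equalities and inequalities are the true ones as
    well.\<close>
  obtain C where C: "enum_op e (diag B) = diag C"
    using emb assms unfolding computable_embedding_def by blast
  have at: "atom_sat (op_struct e B) t \<alpha> \<longleftrightarrow>
    (\<exists>z. z \<in> W e \<and> psnd z = atom_code (subst_atom t \<alpha>) \<and> set_decode (pfst z) \<subseteq> diag B)" for \<alpha>
  proof -
    have "atom_sat (op_struct e B) t \<alpha> \<longleftrightarrow> atom_code (subst_atom t \<alpha>) \<in> enum_op e (diag B)"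
      by (simp add: op_struct_def C struct_of_diag atom_code_mem_diag atom_sat_subst)
    also have "\<dots> \<longleftrightarrow> (\<exists>v. pair v (atom_code (subst_atom t \<alpha>)) \<in> W e \<and> set_decode v \<subseteq> diag B)"
      by (simp add: enum_op_def)
    also have "\<dots> \<longleftrightarrow> (\<exists>z. z \<in> W e \<and> psnd z = atom_code (subst_atom t \<alpha>) \<and> set_decode (pfst z) \<subseteq> diag B)"
      by (metis fst_conv prod.collapse prod_decode_inverse prod_encode_inverse snd_conv)
    finally show ?thesis .
  qed
  show ?thesis
  proof
    assume ?L
    then obtain g where g: "\<And>\<alpha>. \<alpha> \<in> set \<alpha>s \<Longrightarrow> g \<alpha> \<in> W e \<and>
      psnd (g \<alpha>) = atom_code (subst_atom t \<alpha>) \<and> set_decode (pfst (g \<alpha>)) \<subseteq> diag B"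
      unfolding at by metis
    then show ?R by (intro exI[of _ "list_encode (map g \<alpha>s)"]) (simp add: image_subset_iff)
  next
    assume ?R
    then obtain w where w: "set (list_decode w) \<subseteq> W e"
      "map psnd (list_decode w) = map (\<lambda>\<alpha>. atom_code (subst_atom t \<alpha>)) \<alpha>s"
      "\<forall>z\<in>set (list_decode w). set_decode (pfst z) \<subseteq> diag B" by blast
    have "\<exists>z\<in>set (list_decode w). psnd z = atom_code (subst_atom t \<alpha>)" if "\<alpha> \<in> set \<alpha>s" for \<alpha>
    proof -
      have "atom_code (subst_atom t \<alpha>) \<in> set (map psnd (list_decode w))"
        unfolding w(2) using that by simp
      then show ?thesis by auto
    qed
    then show ?L unfolding at using w(1,3) by blast
  qed
qed

section \<open>Formulas of level 1\<close>

definition body :: "nat \<Rightarrow> atom list" where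
  "body y = map atom_of (list_decode (psnd (psnd (mem_ix y))))"

text \<open>The tag is left open so that Sigma and Pi share the analysis: their members carry the
  same lists of atoms, read as a conjunction or as a disjunction of negations.\<close>

context
  fixes d tag k s :: nat and \<alpha>s :: "nat \<Rightarrow> atom list"
  assumes ix: "\<And>i. i \<in> W d \<Longrightarrow> mem_ix i = pair tag (pair 1 (list_encode (map atom_code (\<alpha>s i))))"
begin

lemma member_one:
  assumes "i \<in> W d"
  shows "set (mem_vars (member_one \<tau> i w z k s)) = {k..<k + Suc w}"
    and "mem_ix (member_one \<tau> i w z k s) =
      pair tag (pair 1 (list_encode (map atom_code (body (member_one \<tau> i w z k s)))))"
    and "body (member_one \<tau> i w z k s) =
      (if map psnd (list_decode w) =
        map (\<lambda>\<alpha>. atom_code (subst_atom (lookup (update (pfst i) z s)) \<alpha>)) (\<alpha>s i)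
       then map atom_of (list_decode (atoms_code \<tau> w (k + Suc w))) else [Neq 0 0])"
  using ix[OF assms]
  by (auto simp: member_one_def mem_vars_def mem_ix_def body_def set_range_code comp_def
      subst_codes_list_encode psnds_eq list_encode_eq simp del: list_decode.simps(2))

lemma members_one:
  assumes "y \<in> W (members d 2 k s)"
  shows "mem_ix y = pair tag (pair 1 (list_encode (map atom_code (body y))))"
    and "\<alpha> \<in> set (body y) \<Longrightarrow> atom_in \<tau> \<alpha>"
    and "(\<Union>\<alpha>\<in>set (body y). atom_vars \<alpha>) - set (mem_vars y) \<subseteq> {..<k}"
proof -
  obtain i w z where y: "y = member_one \<tau> i w z k s" "i \<in> W d"
    using assms unfolding W_members_one by blast
  show "mem_ix y = pair tag (pair 1 (list_encode (map atom_code (body y))))"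
    using member_one(2)[OF y(2)] y(1) by simp
  show "\<alpha> \<in> set (body y) \<Longrightarrow> atom_in \<tau> \<alpha>"
    using member_one(3)[OF y(2), of w z] y(1) by (auto split: if_splits intro: atoms_code_atom_in)
  have "atom_vars \<alpha> \<subseteq> {..<k + Suc w}" if "\<alpha> \<in> set (body y)" for \<alpha>
    using that member_one(3)[OF y(2), of w z] y(1) atoms_code_vars[of _ \<tau> w "k + Suc w"]
    by (auto split: if_splits)
  then show "(\<Union>\<alpha>\<in>set (body y). atom_vars \<alpha>) - set (mem_vars y) \<subseteq> {..<k}"
    unfolding y(1) member_one(1)[OF y(2)] by fastforce
qed

text \<open>The inner predicate is open, so nonmeager means satisfied by some bijection extending
  the condition. Such an \<open>f\<close> uses finitely many axioms, and its values on their
  variables serve as witnesses; conversely, distinct values that satisfy the premises extend to a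
  bijection.\<close>

lemma members_one_sat:
  assumes A: "A \<in> K"
  shows "(\<exists>y\<in>W (members d 2 k s). \<exists>t. (\<forall>x. x \<notin> set (mem_vars y) \<longrightarrow> t x = \<sigma> x) \<and>
      (\<forall>\<alpha>\<in>set (body y). atom_sat A t \<alpha>)) \<longleftrightarrow>
    distinct (map \<sigma> [0..<k]) \<and>
      \<not> generically (map \<sigma> [0..<k]) (\<lambda>f. \<not> (\<exists>i\<in>W d. \<exists>t. (\<forall>x. x \<notin> set (mem_vars i) \<longrightarrow> t x = lookup s x) \<and>
        (\<forall>\<alpha>\<in>set (\<alpha>s i). atom_sat (op_struct e (pull f A)) t \<alpha>)))"
    (is "?L \<longleftrightarrow> distinct ?p \<and> \<not> generically ?p (\<lambda>f. \<not> ?P f)")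
proof -
  have AM: "A \<in> Mod \<tau>" using A K(1) by blast
  have P: "?P f \<longleftrightarrow> (\<exists>i\<in>W d. \<exists>u. \<forall>\<alpha>\<in>set (\<alpha>s i). atom_sat (op_struct e (pull f A)) (lookup (update (pfst i) u s)) \<alpha>)" for f
    unfolding mem_vars_def ex_update_iff ..
  have "finitely_determined (\<lambda>f. \<exists>i. i \<in> W d \<and> (\<exists>u. \<forall>\<alpha>\<in>set (\<alpha>s i).
      atom_sat (op_struct e (pull f A)) (lookup (update (pfst i) u s)) \<alpha>))"
    by (intro finitely_determined_Ex finitely_determined_conj finitely_determined_const
        finitely_determined_Ball finitely_determined_atom)
  then have "finitely_determined ?P" unfolding P by (simp add: Bex_def)
  from not_generically_open_iff[OF this]
  have gen: "distinct ?p \<and> \<not> generically ?p (\<lambda>f. \<not> ?P f) \<longleftrightarrow> distinct ?p \<and> (\<exists>f. bij f \<and> extends f ?p \<and> ?P f)"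
    by blast
  have diag: "(\<forall>z\<in>set (list_decode w). set_decode (pfst z) \<subseteq> diag (pull f A)) \<longleftrightarrow>
    (\<forall>z\<in>set (list_decode w). \<forall>c\<in>set_decode (pfst z). atom_sat A t (atom_of c))"
    if "bij f" "\<And>x. x < k + Suc w \<Longrightarrow> f x = t x" for f t w
  proof -
    have "c \<in> diag (pull f A) \<longleftrightarrow> atom_sat A t (atom_of c)"
      if c: "z \<in> set (list_decode w)" "c \<in> set_decode (pfst z)" for z c
    proof -
      have "x < k + Suc w" if "x \<in> atom_vars (atom_of c)" for x
        using atom_vars_le[OF that] set_decode_pfst_less[OF c] by simp
      then have "atom_sat A f (atom_of c) = atom_sat A t (atom_of c)"
        using \<open>\<And>x. x < k + Suc w \<Longrightarrow> f x = t x\<close> by (intro atom_sat_cong) blast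
      then show ?thesis using atom_code_mem_diag_pull[OF \<open>bij f\<close>, of "atom_of c" A] by simp
    qed
    then show ?thesis by blast
  qed
  have "?L \<longleftrightarrow> distinct ?p \<and> (\<exists>f. bij f \<and> extends f ?p \<and> ?P f)"
  proof
    assume ?L
    then obtain i w z t where i: "i \<in> W d" "set (list_decode w) \<subseteq> W e"
      and t: "\<forall>x. x \<notin> {k..<k + Suc w} \<longrightarrow> t x = \<sigma> x"
      and b: "\<forall>\<alpha>\<in>set (body (member_one \<tau> i w z k s)). atom_sat A t \<alpha>"
      unfolding W_members_one using member_one(1) by blast
    define u where "u = lookup (update (pfst i) z s)"
    \<comment> \<open>The mismatch case is excluded, as its body is contradictory.\<close>
    have check: "map psnd (list_decode w) = map (\<lambda>\<alpha>. atom_code (subst_atom u \<alpha>)) (\<alpha>s i)"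
      using b unfolding member_one(3)[OF i(1)] u_def by (auto split: if_splits)
    then have "\<forall>c\<in>set (list_decode (atoms_code \<tau> w (k + Suc w))). atom_sat A t (atom_of c)"
      using b unfolding member_one(3)[OF i(1)] u_def by simp
    then have dist: "distinct (map t [0..<k + Suc w])"
      and sat: "\<forall>z\<in>set (list_decode w). \<forall>c\<in>set_decode (pfst z). atom_sat A t (atom_of c)"
      unfolding atoms_code_sat[OF AM] by blast+
    have pt: "?p = map t [0..<k]" using t by simp
    obtain f where f: "bij f" "extends f (map t [0..<k + Suc w])" using bij_extends[OF dist] by blast
    then have ft: "f x = t x" if "x < k + Suc w" for x
      using that unfolding extends_iff by (metis add_0 diff_zero length_map length_upt nth_map_upt)
    have "\<forall>\<alpha>\<in>set (\<alpha>s i). atom_sat (op_struct e (pull f A)) u \<alpha>"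
      unfolding image_atoms_sat[OF pull_in_K(1)[OF K(2,1) A f(1)]]
      using i(2) check diag[of f w t, OF f(1) ft] sat by blast
    then have "?P f" unfolding P u_def using i(1) by blast
    moreover have "distinct ?p" unfolding pt using dist by (auto simp: distinct_map intro: inj_on_subset)
    moreover have "extends f ?p" unfolding pt using ft by (simp add: extends_iff)
    ultimately show "distinct ?p \<and> (\<exists>f. bij f \<and> extends f ?p \<and> ?P f)" using f(1) by blast
  next
    assume "distinct ?p \<and> (\<exists>f. bij f \<and> extends f ?p \<and> ?P f)"
    then obtain f i z where f: "bij f" "extends f ?p" and i: "i \<in> W d"
      and sat: "\<forall>\<alpha>\<in>set (\<alpha>s i). atom_sat (op_struct e (pull f A)) (lookup (update (pfst i) z s)) \<alpha>"
      unfolding P by blast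
    define u where "u = lookup (update (pfst i) z s)"
    obtain w where w: "set (list_decode w) \<subseteq> W e"
      "map psnd (list_decode w) = map (\<lambda>\<alpha>. atom_code (subst_atom u \<alpha>)) (\<alpha>s i)"
      "\<forall>z\<in>set (list_decode w). set_decode (pfst z) \<subseteq> diag (pull f A)"
      using sat unfolding u_def[symmetric] image_atoms_sat[OF pull_in_K(1)[OF K(2,1) A f(1)]] by blast
    define t where "t x = (if x < k + Suc w then f x else \<sigma> x)" for x
    have "inj_on t {..<k + Suc w}" using f(1) by (auto simp: t_def bij_def inj_on_def)
    then have "distinct (map t [0..<k + Suc w])"
      by (simp add: distinct_map atLeast0LessThan del: upt_Suc)
    moreover have "\<forall>z\<in>set (list_decode w). \<forall>c\<in>set_decode (pfst z). atom_sat A t (atom_of c)"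
      using w(3) diag[of f w t] f(1) by (simp add: t_def)
    ultimately have "\<forall>c\<in>set (list_decode (atoms_code \<tau> w (k + Suc w))). atom_sat A t (atom_of c)"
      unfolding atoms_code_sat[OF AM] by blast
    then have "\<forall>\<alpha>\<in>set (body (member_one \<tau> i w z k s)). atom_sat A t \<alpha>"
      unfolding member_one(3)[OF i] using w(2) by (simp add: u_def)
    moreover have "\<forall>x. x \<notin> {k..<k + Suc w} \<longrightarrow> t x = \<sigma> x"
      using f(2) by (auto simp: t_def extends_iff)
    ultimately show ?L unfolding W_members_one using i w(1) member_one(1)[OF i] by blast
  qed
  then show ?thesis using gen by blast
qed

end

text \<open>
  The translation of \<open>\<phi>\<close> expresses the Vaught transform \<open>\<phi>\<^sup>\<Delta>\<close> (for \<open>\<Pi>\<close>: \<open>\<phi>\<^sup>*\<close>) at the condition given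
  by the values of the first \<open>k\<close> variables. Only the formulas of level 1 mention the distinctness
  of these values; higher levels inherit it, because every member contains both a \<open>\<Sigma>\<close> and a \<open>\<Pi>\<close> part.
\<close>

definition Sigma_spec :: "nat \<Rightarrow> nat \<Rightarrow> fml \<Rightarrow> fml \<Rightarrow> bool" where
  "Sigma_spec k s \<phi> \<Phi> \<longleftrightarrow> (\<forall>A\<in>K. \<forall>\<sigma>. sat A \<Phi> \<sigma> \<longleftrightarrow> distinct (map \<sigma> [0..<k]) \<and>
    \<not> generically (map \<sigma> [0..<k]) (\<lambda>f. \<not> image_sat A \<phi> (lookup s) f))"

definition Pi_spec :: "nat \<Rightarrow> nat \<Rightarrow> fml \<Rightarrow> fml \<Rightarrow> bool" where
  "Pi_spec k s \<phi> \<Phi> \<longleftrightarrow> (\<forall>A\<in>K. \<forall>\<sigma>. sat A \<Phi> \<sigma> \<longleftrightarrow> (distinct (map \<sigma> [0..<k]) \<longrightarrow>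
    generically (map \<sigma> [0..<k]) (image_sat A \<phi> (lookup s))))"

text \<open>All \<open>k\<close> and \<open>s\<close> are quantified because the induction passes to
  longer conditions and updated environments.\<close>

definition Sigma_trans :: "nat \<Rightarrow> nat \<Rightarrow> fml \<Rightarrow> bool" where
  "Sigma_trans a n \<phi> \<longleftrightarrow> (\<forall>k s. \<exists>\<Phi>. Sigma_pc \<tau> (trans_level a) (trans n k s) \<Phi> \<and>
    FV \<Phi> \<subseteq> {..<k} \<and> Sigma_spec k s \<phi> \<Phi>)"

definition Pi_trans :: "nat \<Rightarrow> nat \<Rightarrow> fml \<Rightarrow> bool" where
  "Pi_trans a n \<phi> \<longleftrightarrow> (\<forall>k s. \<exists>\<Phi>. Pi_pc \<tau> (trans_level a) (trans n k s) \<Phi> \<and>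
    FV \<Phi> \<subseteq> {..<k} \<and> Pi_spec k s \<phi> \<Phi>)"

text \<open>The hypothesis on \<open>\<phi>\<close> is semantic, so that formulas of level 0, viewed
  as disjunctions with one member, are covered too.\<close>

lemma Sigma_level_one:
  assumes "\<And>i. i \<in> W d \<Longrightarrow> mem_ix i = Sigma_ix 1 (list_encode (map atom_code (\<alpha>s i)))"
    and "\<And>B t. sat B \<phi> t \<longleftrightarrow> sat B (BigOr (W d) (\<lambda>i. Exs (mem_vars i) (Conj0 (\<alpha>s i)))) t"
  shows "\<exists>\<Phi>. Sigma_pc \<tau> 2 (Sigma_ix 2 (members d 2 k s)) \<Phi> \<and> FV \<Phi> \<subseteq> {..<k} \<and> Sigma_spec k s \<phi> \<Phi>"
proof -
  note ix = assms(1)[unfolded Sigma_ix_def]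
  let ?\<Phi> = "BigOr (W (members d 2 k s)) (\<lambda>y. Exs (mem_vars y) (Conj0 (body y)))"
  have "Sigma_pc \<tau> 1 (mem_ix y) (Conj0 (body y))" if "y \<in> W (members d 2 k s)" for y
    using Sigma_zero[of "body y" \<tau>] members_one(1,2)[OF ix that] by (simp add: Sigma_ix_def)
  then have "Sigma_pc \<tau> 2 (Sigma_ix 2 (members d 2 k s)) ?\<Phi>" by (intro Sigma_one) blast
  moreover have "FV ?\<Phi> \<subseteq> {..<k}" using members_one(3)[OF ix] by fastforce
  moreover have "Sigma_spec k s \<phi> ?\<Phi>"
    unfolding Sigma_spec_def assms(2) using members_one_sat[OF ix] by simp
  ultimately show ?thesis by blast
qed

lemma Pi_level_one:
  assumes "\<And>i. i \<in> W d \<Longrightarrow> mem_ix i = Pi_ix 1 (list_encode (map atom_code (\<alpha>s i)))"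
    and "\<And>B t. sat B \<phi> t \<longleftrightarrow> sat B (BigAnd (W d) (\<lambda>i. Alls (mem_vars i) (Disj0 (\<alpha>s i)))) t"
  shows "\<exists>\<Phi>. Pi_pc \<tau> 2 (Pi_ix 2 (members d 2 k s)) \<Phi> \<and> FV \<Phi> \<subseteq> {..<k} \<and> Pi_spec k s \<phi> \<Phi>"
proof -
  note ix = assms(1)[unfolded Pi_ix_def]
  let ?\<Phi> = "BigAnd (W (members d 2 k s)) (\<lambda>y. Alls (mem_vars y) (Disj0 (body y)))"
  have "Pi_pc \<tau> 1 (mem_ix y) (Disj0 (body y))" if "y \<in> W (members d 2 k s)" for y
    using Pi_zero[of "body y" \<tau>] members_one(1,2)[OF ix that] by (simp add: Pi_ix_def)
  then have "Pi_pc \<tau> 2 (Pi_ix 2 (members d 2 k s)) ?\<Phi>" by (intro Pi_one) blast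
  moreover have "FV ?\<Phi> \<subseteq> {..<k}" using members_one(3)[OF ix] by fastforce
  moreover have "Pi_spec k s \<phi> ?\<Phi>"
  proof -
    \<comment> \<open>Negation turns this Pi formula into the existential statement already
      analysed, in \<open>A\<close> as well as in the image.\<close>
    have dual: "sat B (BigAnd I (\<lambda>i. Alls (v i) (Disj0 (a i)))) t \<longleftrightarrow>
      \<not> (\<exists>i\<in>I. \<exists>t'. (\<forall>x. x \<notin> set (v i) \<longrightarrow> t' x = t x) \<and> (\<forall>\<alpha>\<in>set (a i). atom_sat B t' \<alpha>))" for B I v a t
      unfolding sat.simps by blast
    show ?thesis unfolding Pi_spec_def assms(2) dual using members_one_sat[OF ix] by blast
  qed
  ultimately show ?thesis by blast
qed

text \<open>Formulas must be chosen per code \<open>y\<close>, whereas the specifications refer to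
  \<open>i\<close> and \<open>z\<close>, and different pairs may yield the same code. As an index
  determines the meaning of its formula, one choice per code meets all of them.\<close>

lemma level_step:
  assumes a: "less_O 2 a"
    and IH: "\<forall>i\<in>W d. \<exists>b. less_O b a \<and> Sigma_trans b (mem_Sigma i) (F i) \<and> Pi_trans b (mem_Pi i) (G i)"
  obtains \<Phi> \<Psi> where
    "\<And>y. y \<in> W (members d a k s) \<Longrightarrow>
      \<exists>b. less_O b a \<and> Sigma_pc \<tau> b (mem_Sigma y) (\<Phi> y) \<and> Pi_pc \<tau> b (mem_Pi y) (\<Psi> y)"
    "\<And>y. y \<in> W (members d a k s) \<Longrightarrow> FV (\<Phi> y) \<union> FV (\<Psi> y) - set (mem_vars y) \<subseteq> {..<k}"
    "\<And>i z. i \<in> W d \<Longrightarrow> Sigma_spec (k + pfst z) (update (pfst i) (psnd z) s) (F i)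
      (\<Phi> (member_step q (prog_code T) i z k s))"
    "\<And>i z. i \<in> W d \<Longrightarrow> Pi_spec (k + pfst z) (update (pfst i) (psnd z) s) (G i)
      (\<Psi> (member_step q (prog_code T) i z k s))"
proof -
  let ?X = "W (members d a k s)" and ?M = "\<lambda>i z. member_step q (prog_code T) i z k s"
  have X: "?X = {?M i z | i z. i \<in> W d}" using W_members_step less_O_2_neq[OF a] by blast
  have vars: "set (mem_vars (?M i z)) = {k..<k + pfst z}" for i z
    by (simp add: member_step_def mem_vars_def set_range_code)
  have ixs: "mem_Sigma (?M i z) = trans (mem_Sigma i) (k + pfst z) (update (pfst i) (psnd z) s)"
    "mem_Pi (?M i z) = trans (mem_Pi i) (k + pfst z) (update (pfst i) (psnd z) s)" for i z
    by (simp_all add: member_step_def mem_Sigma_def mem_Pi_def mem_ix_def)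
  have ex: "\<exists>\<phi> \<psi>. (\<exists>b. less_O b a \<and> Sigma_pc \<tau> b (mem_Sigma (?M i z)) \<phi> \<and> Pi_pc \<tau> b (mem_Pi (?M i z)) \<psi>) \<and>
      FV \<phi> \<union> FV \<psi> - set (mem_vars (?M i z)) \<subseteq> {..<k} \<and>
      Sigma_spec (k + pfst z) (update (pfst i) (psnd z) s) (F i) \<phi> \<and>
      Pi_spec (k + pfst z) (update (pfst i) (psnd z) s) (G i) \<psi>" if "i \<in> W d" for i z
  proof -
    obtain b where b: "less_O b a" "Sigma_trans b (mem_Sigma i) (F i)" "Pi_trans b (mem_Pi i) (G i)"
      using IH \<open>i \<in> W d\<close> by blast
    obtain \<phi> where \<phi>: "Sigma_pc \<tau> (trans_level b) (mem_Sigma (?M i z)) \<phi>" "FV \<phi> \<subseteq> {..<k + pfst z}"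
      "Sigma_spec (k + pfst z) (update (pfst i) (psnd z) s) (F i) \<phi>"
      using b(2) unfolding Sigma_trans_def ixs by blast
    obtain \<psi> where \<psi>: "Pi_pc \<tau> (trans_level b) (mem_Pi (?M i z)) \<psi>" "FV \<psi> \<subseteq> {..<k + pfst z}"
      "Pi_spec (k + pfst z) (update (pfst i) (psnd z) s) (G i) \<psi>"
      using b(3) unfolding Pi_trans_def ixs by blast
    \<comment> \<open>A part of level 0 is raised to notation 2, which is still below
      \<open>a\<close>.\<close>
    have "less_O (trans_level b) a" using a b(1) by (simp add: trans_level_def)
    moreover have "FV \<phi> \<union> FV \<psi> - set (mem_vars (?M i z)) \<subseteq> {..<k}"
      unfolding vars using \<phi>(2) \<psi>(2) by fastforce
    ultimately show ?thesis using \<phi> \<psi> by blast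
  qed
  have "\<forall>y. \<exists>\<phi> \<psi>. y \<in> ?X \<longrightarrow>
      (\<exists>b. less_O b a \<and> Sigma_pc \<tau> b (mem_Sigma y) \<phi> \<and> Pi_pc \<tau> b (mem_Pi y) \<psi>) \<and>
      FV \<phi> \<union> FV \<psi> - set (mem_vars y) \<subseteq> {..<k}"
    unfolding X using ex by blast
  then obtain \<Phi> \<Psi> where y: "\<And>y. y \<in> ?X \<Longrightarrow>
      (\<exists>b. less_O b a \<and> Sigma_pc \<tau> b (mem_Sigma y) (\<Phi> y) \<and> Pi_pc \<tau> b (mem_Pi y) (\<Psi> y)) \<and>
      FV (\<Phi> y) \<union> FV (\<Psi> y) - set (mem_vars y) \<subseteq> {..<k}"
    by metis
  have spec: "Sigma_spec (k + pfst z) (update (pfst i) (psnd z) s) (F i) (\<Phi> (?M i z)) \<and>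
      Pi_spec (k + pfst z) (update (pfst i) (psnd z) s) (G i) (\<Psi> (?M i z))" if i: "i \<in> W d" for i z
  proof -
    have "?M i z \<in> ?X" using i unfolding X by blast
    from y[OF this] obtain b where b: "Sigma_pc \<tau> b (mem_Sigma (?M i z)) (\<Phi> (?M i z))"
      "Pi_pc \<tau> b (mem_Pi (?M i z)) (\<Psi> (?M i z))" by blast
    obtain c \<phi> \<psi> where c: "Sigma_pc \<tau> c (mem_Sigma (?M i z)) \<phi>" "Pi_pc \<tau> c (mem_Pi (?M i z)) \<psi>"
      "Sigma_spec (k + pfst z) (update (pfst i) (psnd z) s) (F i) \<phi>"
      "Pi_spec (k + pfst z) (update (pfst i) (psnd z) s) (G i) \<psi>"
      using ex[OF i, of z] by blast
    have "sat A (\<Phi> (?M i z)) \<sigma> = sat A \<phi> \<sigma>" "sat A (\<Psi> (?M i z)) \<sigma> = sat A \<psi> \<sigma>" for A \<sigma>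
      using Sigma_pc_unique[OF b(1) c(1)] Pi_pc_unique[OF b(2) c(2)] by blast+
    then show ?thesis using c(3,4) by (simp add: Sigma_spec_def Pi_spec_def)
  qed
  show thesis
    by (rule that[of \<Phi> \<Psi>]) (use y spec in blast)+
qed

lemma Sigma_level_step:
  assumes a: "less_O 2 a"
    and IH: "\<forall>i\<in>W d. \<exists>b. less_O b a \<and> Sigma_trans b (mem_Sigma i) (F i) \<and> Pi_trans b (mem_Pi i) (G i)"
    and \<phi>: "\<phi> = BigOr (W d) (\<lambda>i. Exs (mem_vars i) (And (F i) (G i)))"
  shows "\<exists>\<Phi>. Sigma_pc \<tau> a (Sigma_ix a (members d a k s)) \<Phi> \<and> FV \<Phi> \<subseteq> {..<k} \<and> Sigma_spec k s \<phi> \<Phi>"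
proof -
  let ?X = "W (members d a k s)" and ?M = "\<lambda>i z. member_step q (prog_code T) i z k s"
  obtain \<Phi> \<Psi> where
    pc: "\<And>y. y \<in> ?X \<Longrightarrow>
      \<exists>b. less_O b a \<and> Sigma_pc \<tau> b (mem_Sigma y) (\<Phi> y) \<and> Pi_pc \<tau> b (mem_Pi y) (\<Psi> y)"
    and FV: "\<And>y. y \<in> ?X \<Longrightarrow> FV (\<Phi> y) \<union> FV (\<Psi> y) - set (mem_vars y) \<subseteq> {..<k}"
    and spec: "\<And>i z. i \<in> W d \<Longrightarrow> Sigma_spec (k + pfst z) (update (pfst i) (psnd z) s) (F i) (\<Phi> (?M i z))"
      "\<And>i z. i \<in> W d \<Longrightarrow> Pi_spec (k + pfst z) (update (pfst i) (psnd z) s) (G i) (\<Psi> (?M i z))"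
    using level_step[OF a IH] by blast
  have X: "?X = {?M i z | i z. i \<in> W d}" using W_members_step less_O_2_neq[OF a] by blast
  have vars: "set (mem_vars (?M i z)) = {k..<k + pfst z}" for i z
    by (simp add: member_step_def mem_vars_def set_range_code)
  let ?\<Phi> = "BigOr ?X (\<lambda>y. Exs (mem_vars y) (And (\<Phi> y) (\<Psi> y)))"
  have "Sigma_pc \<tau> a (Sigma_ix a (members d a k s)) ?\<Phi>" using pc by (intro Sigma_step[OF a]) blast
  moreover have "FV ?\<Phi> \<subseteq> {..<k}" using FV by fastforce
  moreover have "Sigma_spec k s \<phi> ?\<Phi>"
    unfolding Sigma_spec_def
  proof (intro ballI allI)
    fix A and \<sigma> :: "nat \<Rightarrow> nat" assume A: "A \<in> K"
    let ?p = "map \<sigma> [0..<k]"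
    let ?E = "\<lambda>i u p. \<not> generically p (\<lambda>f. \<not> image_sat A (F i) (lookup (update (pfst i) u s)) f)"
    let ?A = "\<lambda>i u p. generically p (image_sat A (G i) (lookup (update (pfst i) u s)))"
    have "sat A ?\<Phi> \<sigma> \<longleftrightarrow> (\<exists>i z. i \<in> W d \<and> (\<exists>t. (\<forall>x. x \<notin> {k..<k + pfst z} \<longrightarrow> t x = \<sigma> x) \<and>
      sat A (\<Phi> (?M i z)) t \<and> sat A (\<Psi> (?M i z)) t))"
      unfolding sat.simps X using vars by blast
    \<comment> \<open>The Sigma part supplies the distinctness that the specification of the Pi part
      presupposes.\<close>
    also have "\<dots> \<longleftrightarrow> (\<exists>i z. i \<in> W d \<and> (\<exists>t. (\<forall>x. x \<notin> {k..<k + pfst z} \<longrightarrow> t x = \<sigma> x) \<and>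
      distinct (map t [0..<k + pfst z]) \<and> ?E i (psnd z) (map t [0..<k + pfst z]) \<and>
      ?A i (psnd z) (map t [0..<k + pfst z])))"
      using spec A unfolding Sigma_spec_def Pi_spec_def by blast
    also have "\<dots> \<longleftrightarrow> (\<exists>i u. i \<in> W d \<and> (\<exists>m t. (\<forall>x. x \<notin> {k..<k + m} \<longrightarrow> t x = \<sigma> x) \<and>
      distinct (map t [0..<k + m]) \<and> ?E i u (map t [0..<k + m]) \<and> ?A i u (map t [0..<k + m])))"
      by (rule ex_pair_iff[of "\<lambda>i. i \<in> W d" "\<lambda>i m u. \<exists>t. (\<forall>x. x \<notin> {k..<k + m} \<longrightarrow> t x = \<sigma> x) \<and>
        distinct (map t [0..<k + m]) \<and> ?E i u (map t [0..<k + m]) \<and> ?A i u (map t [0..<k + m])"])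
    also have "\<dots> \<longleftrightarrow> (\<exists>q i u. ?p \<sqsubseteq> q \<and> i \<in> W d \<and> ?E i u q \<and> ?A i u q)"
      unfolding extension_reindex[of k \<sigma> "\<lambda>m q. ?E i u q \<and> ?A i u q" for i u] by blast
    \<comment> \<open>Membership in \<open>W d\<close> moves into the predicate, because the
      category lemma ranges over a whole countable type; \<open>j\<close> is the pair of
      \<open>i\<close> and \<open>u\<close>.\<close>
    also have "\<dots> \<longleftrightarrow> distinct ?p \<and> (\<exists>q j. ?p \<sqsubseteq> q \<and>
      \<not> generically q (\<lambda>f. \<not> (fst j \<in> W d \<and> image_sat A (F (fst j)) (lookup (update (pfst (fst j)) (snd j) s)) f)) \<and>
      ?A (fst j) (snd j) q)"
    proof -
      have "generically q (\<lambda>f. \<not> (i \<in> W d \<and> P f)) \<longleftrightarrow> i \<notin> W d \<or> generically q (\<lambda>f. \<not> P f)" for q i P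
        by (cases "i \<in> W d") (auto intro: generically_always)
      moreover have "distinct ?p" if "?p \<sqsubseteq> q" for q
        using that by (auto simp: extension_def prefix_def)
      ultimately show ?thesis by auto
    qed
    also have "\<dots> \<longleftrightarrow> distinct ?p \<and> \<not> generically ?p (\<lambda>f. \<not> (\<exists>j.
      (fst j \<in> W d \<and> image_sat A (F (fst j)) (lookup (update (pfst (fst j)) (snd j) s)) f) \<and>
      image_sat A (G (fst j)) (lookup (update (pfst (fst j)) (snd j) s)) f))"
      using not_generically_Ex_iff[of "\<lambda>j. image_sat A (G (fst j)) (lookup (update (pfst (fst j)) (snd j) s))" ?p
        "\<lambda>j f. fst j \<in> W d \<and> image_sat A (F (fst j)) (lookup (update (pfst (fst j)) (snd j) s)) f"] baire_sat
      by blast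
    also have "\<dots> \<longleftrightarrow> distinct ?p \<and> \<not> generically ?p (\<lambda>f. \<not> image_sat A \<phi> (lookup s) f)"
    proof -
      have "image_sat A \<phi> (lookup s) f \<longleftrightarrow> (\<exists>j.
        (fst j \<in> W d \<and> image_sat A (F (fst j)) (lookup (update (pfst (fst j)) (snd j) s)) f) \<and>
        image_sat A (G (fst j)) (lookup (update (pfst (fst j)) (snd j) s)) f)" for f
        unfolding \<phi> sat.simps mem_vars_def ex_update_iff by auto
      then show ?thesis by simp
    qed
    finally show "sat A ?\<Phi> \<sigma> \<longleftrightarrow> distinct ?p \<and> \<not> generically ?p (\<lambda>f. \<not> image_sat A \<phi> (lookup s) f)" .
  qed
  ultimately show ?thesis by blast
qed

lemma Pi_level_step:
  assumes a: "less_O 2 a"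
    and IH: "\<forall>i\<in>W d. \<exists>b. less_O b a \<and> Sigma_trans b (mem_Sigma i) (F i) \<and> Pi_trans b (mem_Pi i) (G i)"
    and \<phi>: "\<phi> = BigAnd (W d) (\<lambda>i. Alls (mem_vars i) (Or (F i) (G i)))"
  shows "\<exists>\<Phi>. Pi_pc \<tau> a (Pi_ix a (members d a k s)) \<Phi> \<and> FV \<Phi> \<subseteq> {..<k} \<and> Pi_spec k s \<phi> \<Phi>"
proof -
  let ?X = "W (members d a k s)" and ?M = "\<lambda>i z. member_step q (prog_code T) i z k s"
  obtain \<Phi> \<Psi> where
    pc: "\<And>y. y \<in> ?X \<Longrightarrow>
      \<exists>b. less_O b a \<and> Sigma_pc \<tau> b (mem_Sigma y) (\<Phi> y) \<and> Pi_pc \<tau> b (mem_Pi y) (\<Psi> y)"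
    and FV: "\<And>y. y \<in> ?X \<Longrightarrow> FV (\<Phi> y) \<union> FV (\<Psi> y) - set (mem_vars y) \<subseteq> {..<k}"
    and spec: "\<And>i z. i \<in> W d \<Longrightarrow> Sigma_spec (k + pfst z) (update (pfst i) (psnd z) s) (F i) (\<Phi> (?M i z))"
      "\<And>i z. i \<in> W d \<Longrightarrow> Pi_spec (k + pfst z) (update (pfst i) (psnd z) s) (G i) (\<Psi> (?M i z))"
    using level_step[OF a IH] by blast
  have X: "?X = {?M i z | i z. i \<in> W d}" using W_members_step less_O_2_neq[OF a] by blast
  have vars: "set (mem_vars (?M i z)) = {k..<k + pfst z}" for i z
    by (simp add: member_step_def mem_vars_def set_range_code)
  let ?\<Phi> = "BigAnd ?X (\<lambda>y. Alls (mem_vars y) (Or (\<Phi> y) (\<Psi> y)))"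
  have "Pi_pc \<tau> a (Pi_ix a (members d a k s)) ?\<Phi>" using pc by (intro Pi_step[OF a]) blast
  moreover have "FV ?\<Phi> \<subseteq> {..<k}" using FV by fastforce
  moreover have "Pi_spec k s \<phi> ?\<Phi>"
    unfolding Pi_spec_def
  proof (intro ballI allI)
    fix A and \<sigma> :: "nat \<Rightarrow> nat" assume A: "A \<in> K"
    let ?p = "map \<sigma> [0..<k]"
    let ?E = "\<lambda>i u p. \<not> generically p (\<lambda>f. \<not> image_sat A (F i) (lookup (update (pfst i) u s)) f)"
    let ?A = "\<lambda>i u p. generically p (image_sat A (G i) (lookup (update (pfst i) u s)))"
    have "\<not> sat A ?\<Phi> \<sigma> \<longleftrightarrow> (\<exists>i z. i \<in> W d \<and> (\<exists>t. (\<forall>x. x \<notin> {k..<k + pfst z} \<longrightarrow> t x = \<sigma> x) \<and>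
      \<not> sat A (\<Phi> (?M i z)) t \<and> \<not> sat A (\<Psi> (?M i z)) t))"
      unfolding sat.simps X using vars by blast
    \<comment> \<open>Here distinctness comes from the failure of the Pi part.\<close>
    also have "\<dots> \<longleftrightarrow> (\<exists>i z. i \<in> W d \<and> (\<exists>t. (\<forall>x. x \<notin> {k..<k + pfst z} \<longrightarrow> t x = \<sigma> x) \<and>
      distinct (map t [0..<k + pfst z]) \<and> \<not> ?E i (psnd z) (map t [0..<k + pfst z]) \<and>
      \<not> ?A i (psnd z) (map t [0..<k + pfst z])))"
      using spec A unfolding Sigma_spec_def Pi_spec_def by blast
    also have "\<dots> \<longleftrightarrow> (\<exists>i u. i \<in> W d \<and> (\<exists>m t. (\<forall>x. x \<notin> {k..<k + m} \<longrightarrow> t x = \<sigma> x) \<and>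
      distinct (map t [0..<k + m]) \<and> \<not> ?E i u (map t [0..<k + m]) \<and> \<not> ?A i u (map t [0..<k + m])))"
      by (rule ex_pair_iff[of "\<lambda>i. i \<in> W d" "\<lambda>i m u. \<exists>t. (\<forall>x. x \<notin> {k..<k + m} \<longrightarrow> t x = \<sigma> x) \<and>
        distinct (map t [0..<k + m]) \<and> \<not> ?E i u (map t [0..<k + m]) \<and> \<not> ?A i u (map t [0..<k + m])"])
    also have "\<dots> \<longleftrightarrow> (\<exists>q i u. ?p \<sqsubseteq> q \<and> i \<in> W d \<and> \<not> ?E i u q \<and> \<not> ?A i u q)"
      unfolding extension_reindex[of k \<sigma> "\<lambda>m q. \<not> ?E i u q \<and> \<not> ?A i u q" for i u] by blast
    \<comment> \<open>For \<open>i\<close> outside \<open>W d\<close> the guarded predicate is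
      always true; its negation is not comeager at \<open>q\<close> by the Baire category theorem,
      so such an \<open>i\<close> imposes nothing.\<close>
    also have "\<dots> \<longleftrightarrow> distinct ?p \<and> \<not> (\<forall>q j. ?p \<sqsubseteq> q \<longrightarrow>
      \<not> generically q (\<lambda>f. \<not> (fst j \<notin> W d \<or> image_sat A (F (fst j)) (lookup (update (pfst (fst j)) (snd j) s)) f)) \<or>
      ?A (fst j) (snd j) q)"
    proof -
      have "generically q (\<lambda>f. \<not> (i \<notin> W d \<or> P f)) \<longleftrightarrow> i \<in> W d \<and> generically q (\<lambda>f. \<not> P f)"
        if "?p \<sqsubseteq> q" for q i P
        using that generically_False[of q] by (cases "i \<in> W d") (auto simp: extension_def)
      moreover have "distinct ?p" if "?p \<sqsubseteq> q" for q
        using that by (auto simp: extension_def prefix_def)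
      ultimately show ?thesis by auto
    qed
    also have "\<dots> \<longleftrightarrow> distinct ?p \<and> \<not> generically ?p (\<lambda>f. \<forall>j.
      (fst j \<notin> W d \<or> image_sat A (F (fst j)) (lookup (update (pfst (fst j)) (snd j) s)) f) \<or>
      image_sat A (G (fst j)) (lookup (update (pfst (fst j)) (snd j) s)) f)"
      using generically_All_iff[of "\<lambda>j f. fst j \<notin> W d \<or> image_sat A (F (fst j)) (lookup (update (pfst (fst j)) (snd j) s)) f" ?p
        "\<lambda>j. image_sat A (G (fst j)) (lookup (update (pfst (fst j)) (snd j) s))"]
        baire_disj[OF baire_const baire_sat]
      by blast
    also have "\<dots> \<longleftrightarrow> distinct ?p \<and> \<not> generically ?p (image_sat A \<phi> (lookup s))"
    proof -
      have "image_sat A \<phi> (lookup s) f \<longleftrightarrow> (\<forall>j.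
        (fst j \<notin> W d \<or> image_sat A (F (fst j)) (lookup (update (pfst (fst j)) (snd j) s)) f) \<or>
        image_sat A (G (fst j)) (lookup (update (pfst (fst j)) (snd j) s)) f)" for f
      proof -
        have all_update_iff: "(\<forall>g. (\<forall>x. x \<notin> set (list_decode xs) \<longrightarrow> g x = lookup s x) \<longrightarrow> P g) \<longleftrightarrow>
          (\<forall>t. P (lookup (update xs t s)))" for xs P
          using ex_update_iff[of xs s "\<lambda>g. \<not> P g"] by blast
        show ?thesis unfolding \<phi> sat.simps mem_vars_def all_update_iff by auto
      qed
      then show ?thesis by presburger
    qed
    finally show "sat A ?\<Phi> \<sigma> \<longleftrightarrow> (distinct ?p \<longrightarrow> generically ?p (image_sat A \<phi> (lookup s)))" by blast
  qed
  ultimately show ?thesis by blast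
qed

lemma
  shows Sigma_translation: "Sigma_pc \<tau>' a n \<phi> \<Longrightarrow> Sigma_trans a n \<phi>"
    and Pi_translation: "Pi_pc \<tau>' a n \<phi> \<Longrightarrow> Pi_trans a n \<phi>"
proof (induction rule: Sigma_pc_Pi_pc.inducts)
  case (Sigma_zero \<alpha>s)
  let ?n = "Sigma_ix 1 (list_encode (map atom_code \<alpha>s))"
  \<comment> \<open>The single member \<open>pair 0 ?n\<close> consists of the empty tuple of
    variables and the original index.\<close>
  have "\<exists>\<Phi>. Sigma_pc \<tau> 2 (Sigma_ix 2 (members (const_code (pair 0 ?n)) 2 k s)) \<Phi> \<and> FV \<Phi> \<subseteq> {..<k} \<and>
    Sigma_spec k s (Conj0 \<alpha>s) \<Phi>" for k s
  proof (rule Sigma_level_one[where \<alpha>s = "\<lambda>i. \<alpha>s"])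
    have "t' = t" if "\<forall>x. t' x = t x" for t t' :: "nat \<Rightarrow> nat" using that by auto
    then show "sat B (Conj0 \<alpha>s) t \<longleftrightarrow>
      sat B (BigOr (W (const_code (pair 0 ?n))) (\<lambda>i. Exs (mem_vars i) (Conj0 \<alpha>s))) t" for B t
      by (auto simp: W_const_code mem_vars_def)
  qed (simp add: W_const_code mem_ix_def)
  then show ?case by (simp add: Sigma_trans_def trans_ix_def trans_level_def Sigma_ix_def)
next
  case (Pi_zero \<alpha>s)
  let ?n = "Pi_ix 1 (list_encode (map atom_code \<alpha>s))"
  have "\<exists>\<Phi>. Pi_pc \<tau> 2 (Pi_ix 2 (members (const_code (pair 0 ?n)) 2 k s)) \<Phi> \<and> FV \<Phi> \<subseteq> {..<k} \<and>
    Pi_spec k s (Disj0 \<alpha>s) \<Phi>" for k s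
  proof (rule Pi_level_one[where \<alpha>s = "\<lambda>i. \<alpha>s"])
    have "t' = t" if "\<forall>x. t' x = t x" for t t' :: "nat \<Rightarrow> nat" using that by auto
    then show "sat B (Disj0 \<alpha>s) t \<longleftrightarrow>
      sat B (BigAnd (W (const_code (pair 0 ?n))) (\<lambda>i. Alls (mem_vars i) (Disj0 \<alpha>s))) t" for B t
      by (auto simp: W_const_code mem_vars_def)
  qed (simp add: W_const_code mem_ix_def)
  then show ?case by (simp add: Pi_trans_def trans_ix_def trans_level_def Pi_ix_def)
next
  case (Sigma_one d G)
  then have "\<forall>i\<in>W d. \<exists>\<alpha>s. mem_ix i = Sigma_ix 1 (list_encode (map atom_code \<alpha>s)) \<and> G i = Conj0 \<alpha>s"
    using Sigma_pc_1E by blast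
  then obtain \<alpha>s where \<alpha>s: "\<And>i. i \<in> W d \<Longrightarrow>
    mem_ix i = Sigma_ix 1 (list_encode (map atom_code (\<alpha>s i))) \<and> G i = Conj0 (\<alpha>s i)" by metis
  have "\<exists>\<Phi>. Sigma_pc \<tau> 2 (Sigma_ix 2 (members d 2 k s)) \<Phi> \<and> FV \<Phi> \<subseteq> {..<k} \<and>
    Sigma_spec k s (BigOr (W d) (\<lambda>i. Exs (mem_vars i) (G i))) \<Phi>" for k s
    by (rule Sigma_level_one) (use \<alpha>s in simp_all)
  then show ?case by (simp add: Sigma_trans_def trans_ix_def trans_level_def Sigma_ix_def)
next
  case (Pi_one d G)
  then have "\<forall>i\<in>W d. \<exists>\<alpha>s. mem_ix i = Pi_ix 1 (list_encode (map atom_code \<alpha>s)) \<and> G i = Disj0 \<alpha>s"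
    using Pi_pc_1E by blast
  then obtain \<alpha>s where \<alpha>s: "\<And>i. i \<in> W d \<Longrightarrow>
    mem_ix i = Pi_ix 1 (list_encode (map atom_code (\<alpha>s i))) \<and> G i = Disj0 (\<alpha>s i)" by metis
  have "\<exists>\<Phi>. Pi_pc \<tau> 2 (Pi_ix 2 (members d 2 k s)) \<Phi> \<and> FV \<Phi> \<subseteq> {..<k} \<and>
    Pi_spec k s (BigAnd (W d) (\<lambda>i. Alls (mem_vars i) (G i))) \<Phi>" for k s
    by (rule Pi_level_one) (use \<alpha>s in simp_all)
  then show ?case by (simp add: Pi_trans_def trans_ix_def trans_level_def Pi_ix_def)
next
  case (Sigma_step a d F G)
  then have "\<forall>i\<in>W d. \<exists>b. less_O b a \<and> Sigma_trans b (mem_Sigma i) (F i) \<and> Pi_trans b (mem_Pi i) (G i)"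
    by blast
  from Sigma_level_step[OF Sigma_step(1) this refl] less_O_2_neq[OF Sigma_step(1)] show ?case
    by (simp add: Sigma_trans_def trans_ix_def trans_level_def Sigma_ix_def)
next
  case (Pi_step a d F G)
  then have "\<forall>i\<in>W d. \<exists>b. less_O b a \<and> Sigma_trans b (mem_Sigma i) (F i) \<and> Pi_trans b (mem_Pi i) (G i)"
    by blast
  from Pi_level_step[OF Pi_step(1) this refl] less_O_2_neq[OF Pi_step(1)] show ?case
    by (simp add: Pi_trans_def trans_ix_def trans_level_def Pi_ix_def)
qed

section \<open>From formulas to sentences\<close>

lemma image_sat_pull:
  assumes "A \<in> K" "bij f" "sentence \<phi>"
  shows "image_sat A \<phi> t f \<longleftrightarrow> op_struct e A \<Turnstile> \<phi>"
proof -
  note pull = pull_in_K[OF K(2,1) assms(1,2)]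
  have "op_struct e A \<cong> op_struct e (pull f A)"
    using emb assms(1) pull unfolding computable_embedding_def by blast
  then show ?thesis using models_iso models_sentence assms(3) by metis
qed

text \<open>At the empty condition the bijections in question are all or none, and by the Baire
  category theorem nonmeager means all. The environment 0 is an arbitrary choice.\<close>

lemma Sigma_sentence:
  assumes "Sigma_pc \<tau>' a n \<phi>" "sentence \<phi>"
  shows "\<exists>\<Phi>. Sigma_pc \<tau> (trans_level a) (trans n 0 0) \<Phi> \<and> sentence \<Phi> \<and>
    (\<forall>A\<in>K. A \<Turnstile> \<Phi> \<longleftrightarrow> op_struct e A \<Turnstile> \<phi>)"
proof -
  obtain \<Phi> where \<Phi>: "Sigma_pc \<tau> (trans_level a) (trans n 0 0) \<Phi>" "FV \<Phi> \<subseteq> {..<0}"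
    "Sigma_spec 0 0 \<phi> \<Phi>"
    using Sigma_translation[OF assms(1)] unfolding Sigma_trans_def by blast
  have "A \<Turnstile> \<Phi> \<longleftrightarrow> op_struct e A \<Turnstile> \<phi>" if A: "A \<in> K" for A
  proof -
    have "A \<Turnstile> \<Phi> \<longleftrightarrow> \<not> generically [] (\<lambda>f. \<not> image_sat A \<phi> (lookup 0) f)"
      using \<Phi>(3) A by (simp add: models_def Sigma_spec_def)
    also have "\<dots> \<longleftrightarrow> \<not> generically [] (\<lambda>f. \<not> op_struct e A \<Turnstile> \<phi>)"
      using image_sat_pull[OF A _ assms(2)] by (auto elim!: generically_mono)
    also have "\<dots> \<longleftrightarrow> op_struct e A \<Turnstile> \<phi>"
      using generically_False[of "[]"] by (cases "op_struct e A \<Turnstile> \<phi>") (auto intro: generically_always)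
    finally show ?thesis .
  qed
  then show ?thesis using \<Phi>(1,2) by (auto simp: sentence_def)
qed

lemma Pi_sentence:
  assumes "Pi_pc \<tau>' a n \<phi>" "sentence \<phi>"
  shows "\<exists>\<Phi>. Pi_pc \<tau> (trans_level a) (trans n 0 0) \<Phi> \<and> sentence \<Phi> \<and>
    (\<forall>A\<in>K. A \<Turnstile> \<Phi> \<longleftrightarrow> op_struct e A \<Turnstile> \<phi>)"
proof -
  obtain \<Phi> where \<Phi>: "Pi_pc \<tau> (trans_level a) (trans n 0 0) \<Phi>" "FV \<Phi> \<subseteq> {..<0}"
    "Pi_spec 0 0 \<phi> \<Phi>"
    using Pi_translation[OF assms(1)] unfolding Pi_trans_def by blast
  have "A \<Turnstile> \<Phi> \<longleftrightarrow> op_struct e A \<Turnstile> \<phi>" if A: "A \<in> K" for A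
  proof -
    have "A \<Turnstile> \<Phi> \<longleftrightarrow> generically [] (image_sat A \<phi> (lookup 0))"
      using \<Phi>(3) A by (simp add: models_def Pi_spec_def)
    also have "\<dots> \<longleftrightarrow> generically [] (\<lambda>f. op_struct e A \<Turnstile> \<phi>)"
      using image_sat_pull[OF A _ assms(2)] by (auto elim!: generically_mono)
    also have "\<dots> \<longleftrightarrow> op_struct e A \<Turnstile> \<phi>"
      using generically_False[of "[]"] by (cases "op_struct e A \<Turnstile> \<phi>") (auto intro: generically_always)
    finally show ?thesis .
  qed
  then show ?thesis using \<Phi>(1,2) by (auto simp: sentence_def)
qed

end

text \<open>
  At level 0 a sentence is an empty conjunction or disjunction, because every atomic formula
  has a variable; it is its own translation.
\<close>

lemma level_zero_sentence:
  assumes "computable_vocab \<tau>'" "\<forall>\<alpha>\<in>set \<alpha>s. atom_in \<tau>' \<alpha>" "(\<Union>\<alpha>\<in>set \<alpha>s. atom_vars \<alpha>) = {}"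
  shows "\<alpha>s = []"
proof -
  have "atom_vars \<alpha> \<noteq> {}" if "\<alpha> \<in> set \<alpha>s" for \<alpha>
    using assms(1,2) that by (cases \<alpha>) (fastforce simp: computable_vocab_def)+
  then show ?thesis using assms(3) by (cases \<alpha>s) auto
qed

theorem mainTheorem4:
  fixes \<tau> \<tau>' :: vocab and K K' :: "struct set" and e :: nat
  assumes "computable_vocab \<tau>" and "computable_vocab \<tau>'"
    and "K \<subseteq> Mod \<tau>" and "K' \<subseteq> Mod \<tau>'"
    and "iso_closed \<tau> K" and "iso_closed \<tau>' K'"
    and "computable_embedding e K K'"
  shows "\<exists>f. computable_fun f \<and>
    (\<forall>a n \<phi>'.
      (Sigma_pc \<tau>' a n \<phi>' \<and> sentence \<phi>' \<longrightarrow>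
        (\<exists>\<phi>. Sigma_pc \<tau> a (f n) \<phi> \<and> sentence \<phi> \<and>
          (\<forall>A\<in>K. A \<Turnstile> \<phi> \<longleftrightarrow> op_struct e A \<Turnstile> \<phi>'))) \<and>
      (Pi_pc \<tau>' a n \<phi>' \<and> sentence \<phi>' \<longrightarrow>
        (\<exists>\<phi>. Pi_pc \<tau> a (f n) \<phi> \<and> sentence \<phi> \<and>
          (\<forall>A\<in>K. A \<Turnstile> \<phi> \<longleftrightarrow> op_struct e A \<Turnstile> \<phi>'))))"
proof -
  obtain q where q: "W q = {w. set (list_decode w) \<subseteq> W e}" using ce_lists by blast
  obtain T where T: "\<And>x y. eval T x y \<longleftrightarrow> y = member \<tau> q x"
    by (rule computable_funE[OF computable_member[OF assms(1), of q]]) blast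
  interpret enum_embedding \<tau> \<tau>' K K' e q T
    by unfold_locales (fact assms q T)+
  \<comment> \<open>Translating an index of level 0 would raise its level. A sentence of that level
    is empty, and its index is valid over either vocabulary, so it is kept.\<close>
  define f where "f n = (if pfst (psnd n) = 1 then n else trans n 0 0)" for n
  have comp: "computable_fun f" unfolding f_def by (intro computable)
  have Sigma: "\<exists>\<phi>. Sigma_pc \<tau> a (f n) \<phi> \<and> sentence \<phi> \<and> (\<forall>A\<in>K. A \<Turnstile> \<phi> \<longleftrightarrow> op_struct e A \<Turnstile> \<phi>')"
    if \<phi>': "Sigma_pc \<tau>' a n \<phi>'" "sentence \<phi>'" for a n \<phi>'
  proof -
    have n: "pfst (psnd n) = a" using \<phi>'(1) by (auto elim!: Sigma_pc_E simp: Sigma_ix_def)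
    show ?thesis
    proof (cases "a = 1")
      case True
      then obtain \<alpha>s where \<alpha>s: "n = Sigma_ix 1 (list_encode (map atom_code \<alpha>s))" "\<phi>' = Conj0 \<alpha>s"
        "\<forall>\<alpha>\<in>set \<alpha>s. atom_in \<tau>' \<alpha>"
        using \<phi>'(1) by (auto elim!: Sigma_pc_E dest: less_O_2_neq)
      then have "\<alpha>s = []"
        using level_zero_sentence[OF assms(2), of \<alpha>s] \<phi>'(2) by (simp add: sentence_def)
      then show ?thesis using \<alpha>s True n Sigma_zero[of "[]" \<tau>] \<phi>'(2)
        by (intro exI[of _ "Conj0 []"]) (simp add: f_def models_def)
    next
      case False
      then show ?thesis using Sigma_sentence[OF \<phi>'] n by (simp add: f_def trans_level_def)
    qed
  qed
  have Pi: "\<exists>\<phi>. Pi_pc \<tau> a (f n) \<phi> \<and> sentence \<phi> \<and> (\<forall>A\<in>K. A \<Turnstile> \<phi> \<longleftrightarrow> op_struct e A \<Turnstile> \<phi>')"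
    if \<phi>': "Pi_pc \<tau>' a n \<phi>'" "sentence \<phi>'" for a n \<phi>'
  proof -
    have n: "pfst (psnd n) = a" using \<phi>'(1) by (auto elim!: Pi_pc_E simp: Pi_ix_def)
    show ?thesis
    proof (cases "a = 1")
      case True
      then obtain \<alpha>s where \<alpha>s: "n = Pi_ix 1 (list_encode (map atom_code \<alpha>s))" "\<phi>' = Disj0 \<alpha>s"
        "\<forall>\<alpha>\<in>set \<alpha>s. atom_in \<tau>' \<alpha>"
        using \<phi>'(1) by (auto elim!: Pi_pc_E dest: less_O_2_neq)
      then have "\<alpha>s = []"
        using level_zero_sentence[OF assms(2), of \<alpha>s] \<phi>'(2) by (simp add: sentence_def)
      then show ?thesis using \<alpha>s True n Pi_zero[of "[]" \<tau>] \<phi>'(2)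
        by (intro exI[of _ "Disj0 []"]) (simp add: f_def models_def)
    next
      case False
      then show ?thesis using Pi_sentence[OF \<phi>'] n by (simp add: f_def trans_level_def)
    qed
  qed
  show ?thesis using comp Sigma Pi by blast
qed

end
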